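(* Let $k,q\geq 1$. For every graph $G$ the following are equivalent: (1) $G$ has a $k$-construction tree of elimination depth at most $q$; (2) $G$ has a tree decomposition of width at most $k-1$ and depth at most $q$; (3) $G\in\mathcal{T}^k_q$, i.e. $G$ admits a $k$-pebble forest cover of depth at most $q$.
   Context: Graphs are finite, simple, undirected. A $k$-labelled graph is a graph with a partial function $\nu\colon[k]\rightharpoonup V$ (each label used at most once); fully labelled means every vertex carries a label. Removing label $\ell$ makes $\nu(\ell)$ undefined. The product of labelled graphs is their disjoint union with equally labelled vertices identified (loops and parallel edges suppressed). A $k$-construction tree for $G$ is a rooted tree $(T,r)$ with a map $\lambda$ from nodes to $k$-labelled graphs such that $\lambda(r)=G$, leaves get fully labelled graphs, each internal node with exactly one child $t'$ (elimination node) gets a graph obtained from $\lambda(t')$ by removing one label, and each internal node with more than one child gets the product of its children's graphs; the elimination depth is the maximum number of elimination nodes on a root-to-leaf path. A tree decomposition $(T,\beta)$ of $G$ is a tree $T$ with bags $\beta(t)\subseteq V(G)$ covering all vertices and all edges, such that each $\{t:v\in\beta(t)\}$ is connected; width is $\max_t|\beta(t)|-1$. Its depth is $\min_{r\in V(T)}\max_{v\in V(T)}|\bigcup_{t\preceq v}\beta(t)|$, where $t\preceq v$ means $t$ lies on the path from $r$ to $v$. A $k$-pebble forest cover of $G$ is a rooted forest (ancestor order $\preceq$) on $V(G)$ with $p\colon V(G)\to[k]$ such that every edge $uv$ has $u\preceq v$ or $v\preceq u$, and if $uv\in E(G)$, $u\prec v$, then every $w$ with $u\prec w\preceq v$ has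 $p(w)\neq p(u)$; its depth is the height (longest chain) of the forest. *)

theory Defs
  imports "Graph_Theory.Digraph_Component" "Graph_Theory.Vertex_Walk"
begin

text \<open>A finite simple undirected graph is a \<open>pair_graph\<close>, i.e. a finite vertex set with a symmetric
  irreflexive edge relation. The empty graph is allowed.\<close>


section \<open>Trees and forests\<close>

text \<open>The library predicates \<open>forest\<close> and \<open>tree\<close> are about directed cycles, and every edge of a
  symmetric graph gives such a cycle of length two. Hence cycles are required to have at least
  three vertices here.\<close>

definition ugraph_cycle :: "'a pair_pre_digraph \<Rightarrow> 'a list \<Rightarrow> bool" where
  "ugraph_cycle T p \<longleftrightarrow> vpath p (with_proj T) \<and> 3 \<le> length p \<and> (last p, hd p) \<in> parcs T"

definition ugraph_forest :: "'a pair_pre_digraph \<Rightarrow> bool" where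
  "ugraph_forest F \<longleftrightarrow> pair_graph F \<and> \<not> (\<exists>p. ugraph_cycle F p)"

definition ugraph_tree :: "'a pair_pre_digraph \<Rightarrow> bool" where
  "ugraph_tree T \<longleftrightarrow> ugraph_forest T \<and> connected (with_proj T)"

definition on_path :: "'a pair_pre_digraph \<Rightarrow> 'a \<Rightarrow> 'a \<Rightarrow> 'a \<Rightarrow> bool" where
  "on_path T r t v \<longleftrightarrow> (\<exists>p. vpath p (with_proj T) \<and> hd p = r \<and> last p = v \<and> t \<in> set p)"

definition rooted_tree :: "'a pair_pre_digraph \<Rightarrow> 'a \<Rightarrow> bool" where
  "rooted_tree T r \<longleftrightarrow> ugraph_tree T \<and> r \<in> pverts T"

definition children :: "'a pair_pre_digraph \<Rightarrow> 'a \<Rightarrow> 'a \<Rightarrow> 'a set" where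
  "children T r t = {s. (t, s) \<in> parcs T \<and> on_path T r t s}"

definition leaves :: "'a pair_pre_digraph \<Rightarrow> 'a \<Rightarrow> 'a set" where
  "leaves T r = {t \<in> pverts T. children T r t = {}}"

text \<open>A rooted forest has exactly one root in each component.\<close>

definition rooted_forest :: "'a pair_pre_digraph \<Rightarrow> 'a set \<Rightarrow> bool" where
  "rooted_forest F R \<longleftrightarrow> ugraph_forest F \<and> R \<subseteq> pverts F \<and>
     (\<forall>v\<in>pverts F. \<exists>!r. r \<in> R \<and> r \<rightarrow>\<^sup>*\<^bsub>with_proj F\<^esub> v)"

definition forest_le :: "'a pair_pre_digraph \<Rightarrow> 'a set \<Rightarrow> 'a \<Rightarrow> 'a \<Rightarrow> bool" where
  "forest_le F R u v \<longleftrightarrow> (\<exists>r\<in>R. on_path F r u v)"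

definition forest_less :: "'a pair_pre_digraph \<Rightarrow> 'a set \<Rightarrow> 'a \<Rightarrow> 'a \<Rightarrow> bool" where
  "forest_less F R u v \<longleftrightarrow> forest_le F R u v \<and> u \<noteq> v"

definition forest_height :: "'a pair_pre_digraph \<Rightarrow> 'a set \<Rightarrow> nat" where
  "forest_height F R =
     Max (card ` {C. C \<subseteq> pverts F \<and> (\<forall>u\<in>C. \<forall>v\<in>C. forest_le F R u v \<or> forest_le F R v u)})"


section \<open>Labelled graphs\<close>

record 'a lgraph =
  lg_graph :: "'a pair_pre_digraph"
  lg_label :: "nat \<rightharpoonup> 'a"

text \<open>The labelling need not be injective: one vertex may carry several labels.\<close>

definition k_labelled :: "nat \<Rightarrow> 'a lgraph \<Rightarrow> bool" where
  "k_labelled k H \<longleftrightarrow> pair_graph (lg_graph H) \<and>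
     dom (lg_label H) \<subseteq> {1..k} \<and> ran (lg_label H) \<subseteq> pverts (lg_graph H)"

definition fully_labelled :: "'a lgraph \<Rightarrow> bool" where
  "fully_labelled H \<longleftrightarrow> pverts (lg_graph H) \<subseteq> ran (lg_label H)"

definition unlabelled :: "'a pair_pre_digraph \<Rightarrow> 'a lgraph" where
  "unlabelled G = \<lparr>lg_graph = G, lg_label = Map.empty\<rparr>"

definition remove_label :: "nat \<Rightarrow> 'a lgraph \<Rightarrow> 'a lgraph" where
  "remove_label l H = H\<lparr>lg_label := (lg_label H)(l := None)\<rparr>"

definition lgraph_iso :: "'a lgraph \<Rightarrow> 'b lgraph \<Rightarrow> bool" where
  "lgraph_iso H K \<longleftrightarrow> (\<exists>f. bij_betw f (pverts (lg_graph H)) (pverts (lg_graph K)) \<and>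
     (\<forall>u\<in>pverts (lg_graph H). \<forall>v\<in>pverts (lg_graph H).
        (u, v) \<in> parcs (lg_graph H) \<longleftrightarrow> (f u, f v) \<in> parcs (lg_graph K)) \<and>
     (\<forall>l. lg_label K l = map_option f (lg_label H l)))"

text \<open>The product of a family \<open>(H i)\<^sub>i\<^sub>\<in>\<^sub>I\<close> is the quotient of the disjoint union by the equivalence
  relation generated by having a common label. As a vertex may carry several labels, taking the
  transitive closure is necessary, and the quotient can create loops.\<close>

definition common_label :: "'i set \<Rightarrow> ('i \<Rightarrow> 'a lgraph) \<Rightarrow> ('i \<times> 'a) rel" where
  "common_label I H = {((i, x), (j, y)) | i x j y. i \<in> I \<and> j \<in> I \<and>
     (\<exists>l. lg_label (H i) l = Some x \<and> lg_label (H j) l = Some y)}"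

definition glue :: "'i set \<Rightarrow> ('i \<Rightarrow> 'a lgraph) \<Rightarrow> 'i \<times> 'a \<Rightarrow> ('i \<times> 'a) set" where
  "glue I H z = (common_label I H)\<^sup>* `` {z}"

definition lg_product :: "'i set \<Rightarrow> ('i \<Rightarrow> 'a lgraph) \<Rightarrow> ('i \<times> 'a) set lgraph" where
  "lg_product I H =
     \<lparr>lg_graph =
        \<lparr>pverts = {glue I H (i, x) | i x. i \<in> I \<and> x \<in> pverts (lg_graph (H i))},
         parcs = {(glue I H (i, x), glue I H (i, y)) | i x y.
           i \<in> I \<and> (x, y) \<in> parcs (lg_graph (H i)) \<and> glue I H (i, x) \<noteq> glue I H (i, y)}\<rparr>,
      lg_label = (\<lambda>l. if \<exists>i\<in>I. l \<in> dom (lg_label (H i))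
        then Some (THE X. \<exists>i\<in>I. \<exists>x. lg_label (H i) l = Some x \<and> X = glue I H (i, x))
        else None)\<rparr>"


section \<open>Construction trees\<close>

text \<open>The product is determined up to isomorphism only, so the graphs at the product nodes and at
  the root are prescribed up to (label-preserving) isomorphism.\<close>

definition construction_tree ::
  "nat \<Rightarrow> 'b lgraph \<Rightarrow> 'n pair_pre_digraph \<Rightarrow> 'n \<Rightarrow> ('n \<Rightarrow> 'a lgraph) \<Rightarrow> bool" where
  "construction_tree k G T r lam \<longleftrightarrow> rooted_tree T r \<and>
     (\<forall>t\<in>pverts T. k_labelled k (lam t)) \<and>
     lgraph_iso (lam r) G \<and>
     (\<forall>t\<in>leaves T r. fully_labelled (lam t)) \<and>
     (\<forall>t\<in>pverts T. \<forall>s. children T r t = {s} \<longrightarrow>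
        (\<exists>l\<in>dom (lg_label (lam s)). lam t = remove_label l (lam s))) \<and>
     (\<forall>t\<in>pverts T. card (children T r t) > 1 \<longrightarrow>
        lgraph_iso (lam t) (lg_product (children T r t) lam))"

definition elimination_nodes :: "'n pair_pre_digraph \<Rightarrow> 'n \<Rightarrow> 'n set" where
  "elimination_nodes T r = {t \<in> pverts T. card (children T r t) = 1}"

definition elimination_depth :: "'n pair_pre_digraph \<Rightarrow> 'n \<Rightarrow> nat" where
  "elimination_depth T r =
     Max ((\<lambda>v. card {t \<in> elimination_nodes T r. on_path T r t v}) ` leaves T r)"


section \<open>Tree decompositions\<close>

definition tree_decomposition ::
  "'a pair_pre_digraph \<Rightarrow> 'n pair_pre_digraph \<Rightarrow> ('n \<Rightarrow> 'a set) \<Rightarrow> bool" where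
  "tree_decomposition G T \<beta> \<longleftrightarrow> ugraph_tree T \<and>
     (\<forall>t\<in>pverts T. \<beta> t \<subseteq> pverts G) \<and>
     (\<forall>v\<in>pverts G. \<exists>t\<in>pverts T. v \<in> \<beta> t) \<and>
     (\<forall>(u, v)\<in>parcs G. \<exists>t\<in>pverts T. u \<in> \<beta> t \<and> v \<in> \<beta> t) \<and>
     (\<forall>v\<in>pverts G. connected (with_proj T \<restriction> {t \<in> pverts T. v \<in> \<beta> t}))"

definition td_width :: "'n pair_pre_digraph \<Rightarrow> ('n \<Rightarrow> 'a set) \<Rightarrow> int" where
  "td_width T \<beta> = int (Max ((\<lambda>t. card (\<beta> t)) ` pverts T)) - 1"

definition td_depth :: "'n pair_pre_digraph \<Rightarrow> ('n \<Rightarrow> 'a set) \<Rightarrow> nat" where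
  "td_depth T \<beta> =
     Min ((\<lambda>r. Max ((\<lambda>v. card (\<Union>t\<in>{t. on_path T r t v}. \<beta> t)) ` pverts T)) ` pverts T)"


section \<open>Pebble forest covers\<close>

definition pebble_forest_cover ::
  "nat \<Rightarrow> 'a pair_pre_digraph \<Rightarrow> 'a pair_pre_digraph \<Rightarrow> 'a set \<Rightarrow> ('a \<Rightarrow> nat) \<Rightarrow> bool" where
  "pebble_forest_cover k G F R p \<longleftrightarrow> rooted_forest F R \<and> pverts F = pverts G \<and>
     (\<forall>v\<in>pverts G. p v \<in> {1..k}) \<and>
     (\<forall>(u, v)\<in>parcs G. forest_le F R u v \<or> forest_le F R v u) \<and>
     (\<forall>(u, v)\<in>parcs G. forest_less F R u v \<longrightarrow>
        (\<forall>w. forest_less F R u w \<and> forest_le F R w v \<longrightarrow> p w \<noteq> p u))"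

definition pebble_forest_class :: "nat \<Rightarrow> nat \<Rightarrow> 'a pair_pre_digraph set" where
  "pebble_forest_class k q =
     {G. pair_graph G \<and> (\<exists>F R p. pebble_forest_cover k G F R p \<and> forest_height F R \<le> q)}"

end

theory Submission
  imports Defs
begin

text \<open>
  The proof goes around the cycle (1) \<open>\<Longrightarrow>\<close> (2) \<open>\<Longrightarrow>\<close> (3) \<open>\<Longrightarrow>\<close> (1).

  (1) \<open>\<Longrightarrow>\<close> (2): keep the tree, and let the bag of a node be the image in \<open>G\<close> of its labelled vertices.
  Descending the tree, the preimage of a vertex is a single unlabelled vertex in a single child until
  an elimination node labels it, and all its preimages are labelled from there on; so the bags
  containing it are connected. Only elimination nodes enlarge the union of the bags along a path.

  (2) \<open>\<Longrightarrow>\<close> (3): order the vertices by the topmost node whose bag contains them, breaking ties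
  arbitrarily, and colour greedily from the root so that colours differ within each bag.

  (3) \<open>\<Longrightarrow>\<close> (1): a forest vertex \<open>x\<close> gets the graph induced on its descendants together with the
  ancestors that still hold their pebble at \<open>x\<close>, labelled by pebbles. It is the product of the
  graphs of the children of \<open>x\<close>, each with the label of that child removed, and of a fully labelled
  graph on the pebbled ancestors.
\<close>

section \<open>Walks and connectedness\<close>

text \<open>Three obstacles shape the development. One vertex may carry several labels, so a product
  can merge vertices even of a single factor; the maps from child graphs towards \<open>G\<close>
  are therefore known to be injective only over unlabelled vertices. Trees and forests are
  undirected graphs, so each is first turned into a parent function with a measure \<open>d\<close>
  that drops towards the root, and paths into ancestor relations; condition (3) is then restated for
  an abstract order in \<open>pebbled_order\<close>, which lets (2) => (3) define its order
  directly. Finally, the construction tree has to live on natural numbers, which is why vertices are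
  renamed to positive numbers and nodes are coded by residues.

  The bounds fit exactly: a bag of at most k vertices contains the vertex to be coloured, so fewer
  than k colours are forbidden; and the root graph is unlabelled, so its bag is empty and the bags
  up to a node hold at most as many vertices as there are elimination nodes strictly above that
  node.\<close>

lemma pair_graph_iff:
  "pair_graph G \<longleftrightarrow> finite (pverts G) \<and> parcs G \<subseteq> pverts G \<times> pverts G \<and> sym (parcs G) \<and>
     irrefl (parcs G)"
proof
  assume "pair_graph G"
  then interpret pair_graph G .
  show "finite (pverts G) \<and> parcs G \<subseteq> pverts G \<times> pverts G \<and> sym (parcs G) \<and> irrefl (parcs G)"
    using pair_finite_verts arc_fst_in_verts arc_snd_in_verts pair_no_loops pair_sym_arcs
    by (fastforce simp: symmetric_def irrefl_def)
next
  assume *: "finite (pverts G) \<and> parcs G \<subseteq> pverts G \<times> pverts G \<and> sym (parcs G) \<and> irrefl (parcs G)"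
  then have "finite (parcs G)" by (meson finite_SigmaI finite_subset)
  with * show "pair_graph G"
    by unfold_locales (auto simp: symmetric_def irrefl_def)
qed

lemma rtrancl_crossing:
  assumes "(a, b) \<in> r\<^sup>*" "a \<in> S" "b \<notin> S"
  shows "\<exists>x y. (x, y) \<in> r \<and> x \<in> S \<and> y \<notin> S"
  using assms by (induction rule: rtrancl_induct) auto

text \<open>The library's connectivity is strong connectivity of the symmetric closure, which adds
  no arcs when \<open>T\<close> is symmetric. Nonemptiness is part of it: the graph induced on the
  empty set is not connected.\<close>

lemma connected_induced_iff:
  assumes "pair_graph T"
  shows "connected (with_proj T \<restriction> S) \<longleftrightarrow> S \<noteq> {} \<and> (\<forall>u\<in>S. \<forall>v\<in>S. (u, v) \<in> (parcs T \<inter> S \<times> S)\<^sup>*)"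
proof -
  have arcs: "parcs (mk_symmetric (with_proj T \<restriction> S)) = parcs T \<inter> S \<times> S"
    using assms by (auto simp: parcs_mk_symmetric pair_graph_iff sym_def)
  have "u \<rightarrow>\<^sup>*\<^bsub>with_proj (mk_symmetric (with_proj T \<restriction> S))\<^esub> v \<longleftrightarrow> (u, v) \<in> (parcs T \<inter> S \<times> S)\<^sup>*"
    if "u \<in> S" "v \<in> S" for u v
  proof
    assume "u \<rightarrow>\<^sup>*\<^bsub>with_proj (mk_symmetric (with_proj T \<restriction> S))\<^esub> v"
    then have "(u, v) \<in> (parcs (mk_symmetric (with_proj T \<restriction> S)))\<^sup>*"
      unfolding reachable_def with_proj_simps by (rule rtrancl_on_rtranclI)
    then show "(u, v) \<in> (parcs T \<inter> S \<times> S)\<^sup>*" by (simp only: arcs)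
  next
    assume "(u, v) \<in> (parcs T \<inter> S \<times> S)\<^sup>*"
    then have "(u, v) \<in> rtrancl_on S (parcs T \<inter> S \<times> S)"
      by (rule rtrancl_consistent_rtrancl_on) (use that in auto)
    then show "u \<rightarrow>\<^sup>*\<^bsub>with_proj (mk_symmetric (with_proj T \<restriction> S))\<^esub> v"
      unfolding reachable_def with_proj_simps arcs pverts_mk_symmetric induce_subgraph_verts .
  qed
  then show ?thesis
    by (auto simp: connected_def strongly_connected_def)
qed

lemma connected_iff:
  assumes "pair_graph T"
  shows "connected (with_proj T) \<longleftrightarrow>
    pverts T \<noteq> {} \<and> (\<forall>u\<in>pverts T. \<forall>v\<in>pverts T. (u, v) \<in> (parcs T)\<^sup>*)"
proof -
  have "with_proj T \<restriction> pverts T = with_proj T"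
    using assms by (auto simp: induce_subgraph_def with_proj_def pair_graph_iff)
  moreover have "parcs T \<inter> pverts T \<times> pverts T = parcs T"
    using assms by (auto simp: pair_graph_iff)
  ultimately show ?thesis using connected_induced_iff[OF assms, of "pverts T"] by simp
qed

lemma reachable_iff:
  assumes "pair_graph G"
  shows "u \<rightarrow>\<^sup>*\<^bsub>with_proj G\<^esub> v \<longleftrightarrow> u \<in> pverts G \<and> v \<in> pverts G \<and> (u, v) \<in> (parcs G)\<^sup>*"
proof -
  interpret pair_graph G by fact
  show ?thesis unfolding reachable_conv by auto
qed

section \<open>Forests given by a parent function\<close>

text \<open>\<open>d\<close> is any measure that drops from a vertex to its parent, not necessarily
  the depth. It excludes cycles of \<open>par\<close> and carries the inductions.\<close>

locale parent_forest =
  fixes V :: "'a set" and R :: "'a set" and par :: "'a \<Rightarrow> 'a" and d :: "'a \<Rightarrow> nat"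
  assumes finite_V: "finite V" and R_sub: "R \<subseteq> V"
    and par_in: "v \<in> V - R \<Longrightarrow> par v \<in> V" and par_d: "v \<in> V - R \<Longrightarrow> d (par v) < d v"
begin

definition up :: "'a rel" where
  "up = {(v, par v) | v. v \<in> V - R}"

definition le :: "'a \<Rightarrow> 'a \<Rightarrow> bool" where
  "le u v \<longleftrightarrow> v \<in> V \<and> (v, u) \<in> up\<^sup>*"

definition graph :: "'a pair_pre_digraph" where
  "graph = \<lparr>pverts = V, parcs = up \<union> up\<inverse>\<rparr>"

lemma pverts_graph [simp]: "pverts graph = V"
  by (simp add: graph_def)

lemma parcs_graph: "parcs graph = up \<union> up\<inverse>"
  by (simp add: graph_def)

lemma up_iff: "(v, u) \<in> up \<longleftrightarrow> v \<in> V - R \<and> u = par v"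
  by (auto simp: up_def)

lemma le_refl: "v \<in> V \<Longrightarrow> le v v"
  by (simp add: le_def)

lemma le_par: "v \<in> V - R \<Longrightarrow> le (par v) v"
  by (auto simp: le_def up_iff)

lemma le_inD: "le u v \<Longrightarrow> u \<in> V \<and> v \<in> V"
proof -
  assume "le u v"
  then have "(v, u) \<in> up\<^sup>*" "v \<in> V" by (auto simp: le_def)
  then show ?thesis by (induction rule: rtrancl_induct) (auto simp: up_iff par_in)
qed

lemma le_trans: "le u v \<Longrightarrow> le v w \<Longrightarrow> le u w"
  by (auto simp: le_def)

lemma le_d: "le u v \<Longrightarrow> u = v \<or> d u < d v"
proof -
  assume "le u v"
  then have "(v, u) \<in> up\<^sup>*" by (auto simp: le_def)
  then show ?thesis
    using par_d by (induction rule: rtrancl_induct) (fastforce simp: up_iff)+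
qed

lemma le_antisym: "le u v \<Longrightarrow> le v u \<Longrightarrow> u = v"
  using le_d[of u v] le_d[of v u] by auto

lemma le_unfold: "le u v \<longleftrightarrow> v \<in> V \<and> (u = v \<or> v \<in> V - R \<and> le u (par v))"
proof
  assume *: "le u v"
  then have "v \<in> V" "(v, u) \<in> up\<^sup>*" by (auto simp: le_def)
  from this(2) show "v \<in> V \<and> (u = v \<or> v \<in> V - R \<and> le u (par v))"
  proof (cases rule: converse_rtranclE)
    case (step y)
    then show ?thesis using par_in[of v] by (simp add: le_def up_iff)
  qed (use \<open>v \<in> V\<close> in simp)
next
  assume "v \<in> V \<and> (u = v \<or> v \<in> V - R \<and> le u (par v))"
  then show "le u v" using le_refl[of v] le_par[of v] le_trans[of u "par v" v] by blast
qed

lemma le_root: "r \<in> R \<Longrightarrow> le u r \<longleftrightarrow> u = r"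
  using R_sub le_unfold[of u r] by auto

lemma le_rootD: "r \<in> R \<Longrightarrow> le u r \<Longrightarrow> u = r"
  by (simp add: le_root)

lemma not_le_par: "v \<in> V - R \<Longrightarrow> \<not> le v (par v)"
  using le_d[of v "par v"] par_d[of v] by auto

lemma par_induct [consumes 1, case_names root step]:
  assumes "v \<in> V"
    and root: "\<And>r. r \<in> R \<Longrightarrow> P r"
    and step: "\<And>v. v \<in> V - R \<Longrightarrow> P (par v) \<Longrightarrow> P v"
  shows "P v"
  using assms(1)
proof (induction "d v" arbitrary: v rule: less_induct)
  case less
  show ?case
  proof (cases "v \<in> R")
    case False
    with less show ?thesis using par_in par_d step by blast
  qed (rule root)
qed

lemma le_chain: "le u w \<Longrightarrow> le v w \<Longrightarrow> le u v \<or> le v u"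
proof -
  assume *: "le u w" "le v w"
  then have "w \<in> V" by (simp add: le_def)
  from this * show ?thesis
  proof (induction w rule: par_induct)
    case (root r)
    then have "u = r" "v = r" by (simp_all add: le_root)
    then show ?case using \<open>le u r\<close> by simp
  next
    case (step w)
    consider "u = w" | "v = w" | "le u (par w)" "le v (par w)"
      using step.prems[THEN le_unfold[THEN iffD1]] by blast
    then show ?case by cases (use step in auto)
  qed
qed

lemma ex_root: "v \<in> V \<Longrightarrow> \<exists>r\<in>R. le r v"
proof (induction v rule: par_induct)
  case (root r)
  then show ?case using R_sub le_refl by blast
next
  case (step v)
  then show ?case using le_par le_trans by blast
qed

lemma root_unique: "r \<in> R \<Longrightarrow> r' \<in> R \<Longrightarrow> le r v \<Longrightarrow> le r' v \<Longrightarrow> r = r'"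
  using le_chain[of r v r'] le_root[of r r'] le_root[of r' r] by auto

lemma pair_graph_graph: "pair_graph graph"
proof -
  have "v \<noteq> par v" if "v \<in> V" "v \<notin> R" for v
    using par_d[of v] that by auto
  then show ?thesis
    by (auto simp: pair_graph_iff parcs_graph up_iff finite_V par_in sym_def irrefl_def)
qed

section \<open>Paths, cycles and components of the forest graph\<close>

sublocale G: pair_graph graph
  by (rule pair_graph_graph)

text \<open>By induction the ancestors of the last vertex are already on the path, so a path that
  starts at a root can never step to a parent: every step goes to a child.\<close>

lemma vpath_set:
  assumes "vpath p (with_proj graph)" "hd p \<in> R"
  shows "set p = {u. le u (last p)}"
  using assms
proof (induction p rule: rev_induct)
  case Nil
  then show ?case by (auto simp: vpath_def vwalk_def)
next
  case (snoc v p)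
  show ?case
  proof (cases "p = []")
    case True
    with snoc.prems show ?thesis by (auto simp: le_root)
  next
    case False
    with snoc.prems have p: "vpath p (with_proj graph)" "hd p \<in> R" and v: "v \<notin> set p" "v \<in> V"
      and e: "(last p, v) \<in> up \<or> (v, last p) \<in> up"
      using vwalkI_append_l by (fastforce simp: vpath_def vwalk_def vwalk_arcs_append parcs_graph)+
    have IH: "set p = {u. le u (last p)}" using snoc.IH p by blast
    have "(last p, v) \<notin> up"
      using v IH le_par up_iff by auto
    with e have "v \<in> V - R" "last p = par v" by (auto simp: up_iff)
    then show ?thesis using IH le_unfold[of _ v] v(2) by auto
  qed
qed

lemma ex_vpath:
  assumes "v \<in> V"
  shows "\<exists>p. vpath p (with_proj graph) \<and> hd p \<in> R \<and> last p = v"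
  using assms
proof (induction v rule: par_induct)
  case (root r)
  then show ?case using R_sub by (intro exI[of _ "[r]"]) (auto simp: vpath_def vwalk_def)
next
  case (step v)
  then obtain p where p: "vpath p (with_proj graph)" "hd p \<in> R" "last p = par v" by blast
  have "v \<notin> set p" using vpath_set[OF p(1,2)] p(3) not_le_par step by auto
  moreover have "p \<noteq> []" using p by (auto simp: vpath_def vwalk_def)
  ultimately have "vpath (p @ [v]) (with_proj graph)"
    using p step
    by (auto simp: vpath_def vwalk_def vwalk_arcs_append parcs_graph up_iff)
  then show ?case using p \<open>p \<noteq> []\<close> by (intro exI[of _ "p @ [v]"]) auto
qed

lemma on_path_iff:
  assumes "r \<in> R"
  shows "on_path graph r t v \<longleftrightarrow> le r v \<and> le t v"
proof
  assume "on_path graph r t v"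
  then obtain p where "vpath p (with_proj graph)" "hd p = r" "last p = v" "t \<in> set p"
    by (auto simp: on_path_def)
  moreover from this have "r \<in> set p" by (metis hd_in_set list.set(1) empty_iff)
  ultimately show "le r v \<and> le t v" using vpath_set assms by blast
next
  assume *: "le r v \<and> le t v"
  then obtain p where p: "vpath p (with_proj graph)" "hd p \<in> R" "last p = v"
    using ex_vpath le_inD by meson
  moreover from this have "hd p \<in> set p" by (auto simp: vpath_def vwalk_def)
  ultimately show "on_path graph r t v"
    unfolding on_path_def using vpath_set[OF p(1,2)] * root_unique[of r "hd p" v] assms
    by (intro exI[of _ p]) auto
qed

lemma forest_le_graph: "forest_le graph R = le"
proof (intro ext iffI)
  fix u v assume "le u v"
  moreover from this obtain r where "r \<in> R" "le r v" using ex_root le_inD by blast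
  ultimately show "forest_le graph R u v" by (auto simp: forest_le_def on_path_iff)
qed (auto simp: forest_le_def on_path_iff)

text \<open>At a vertex of maximal \<open>d\<close> on the cycle, both cyclic neighbours would have
  to be its parent.\<close>

lemma no_cycle: "\<not> ugraph_cycle graph p"
proof
  assume "ugraph_cycle graph p"
  then have p: "set p \<subseteq> V" "set (vwalk_arcs p) \<subseteq> parcs graph" "distinct p" "3 \<le> length p"
    and closing: "(last p, hd p) \<in> parcs graph"
    by (auto simp: ugraph_cycle_def vpath_def vwalk_def)
  define n where "n = length p"
  have step: "(p ! i, p ! Suc i) \<in> parcs graph" if "Suc i < n" for i
  proof -
    have "(p ! i, p ! Suc i) \<in> set (vwalk_arcs p)"
      using that unfolding n_def
    proof (induction p arbitrary: i rule: vwalk_arcs.induct)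
      case (3 x y xs)
      then show ?case by (cases i) auto
    qed auto
    with p show ?thesis by blast
  qed
  have n: "3 \<le> n" and wrap: "(p ! (n - 1), p ! 0) \<in> parcs graph"
  proof -
    have "p \<noteq> []" using p by auto
    then show "3 \<le> n" "(p ! (n - 1), p ! 0) \<in> parcs graph"
      using p closing by (simp_all add: n_def last_conv_nth hd_conv_nth)
  qed
  have nxt: "(p ! i, p ! (Suc i mod n)) \<in> parcs graph" if "i < n" for i
    using that step[of i] wrap by (cases "Suc i = n") auto
  obtain i where i: "i < n" and max: "\<And>j. j < n \<Longrightarrow> d (p ! j) \<le> d (p ! i)"
  proof -
    let ?D = "(\<lambda>j. d (p ! j)) ` {..<n}"
    have D: "finite ?D" "?D \<noteq> {}" using n by (auto simp: lessThan_empty_iff)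
    obtain i where "i < n" "d (p ! i) = Max ?D" using Max_in[OF D] by auto
    with D that[of i] show ?thesis by simp
  qed
  have nb: "p ! j = par (p ! i)" if "j < n" "(p ! i, p ! j) \<in> parcs graph" for j
    using that max[of j] par_d by (force simp: parcs_graph up_iff)
  \<comment> \<open>\<open>a\<close> and \<open>b\<close> are the cyclic successor and predecessor
    of the index \<open>i\<close>; they differ because \<open>n\<close> is at least 3.\<close>
  define a where "a = Suc i mod n"
  define b where "b = (if i = 0 then n - 1 else i - 1)"
  have ab: "a < n" "b < n" using n i by (auto simp: a_def b_def)
  have "a \<noteq> b" using n i by (auto simp: a_def b_def mod_Suc)
  have "Suc b mod n = i" using n i by (auto simp: b_def)
  then have "(p ! i, p ! b) \<in> parcs graph"
    using nxt[OF ab(2)] by (auto simp: parcs_graph)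
  moreover have "(p ! i, p ! a) \<in> parcs graph" using nxt[OF i] by (simp add: a_def)
  ultimately have "p ! a = p ! b" using nb ab by metis
  with \<open>a \<noteq> b\<close> ab p(3) show False by (simp add: n_def nth_eq_iff_index_eq)
qed

lemma ugraph_forest_graph: "ugraph_forest graph"
  unfolding ugraph_forest_def using no_cycle pair_graph_graph by blast

text \<open>A root above \<open>y\<close> stays above \<open>par y\<close>, since a vertex with a
  parent is not a root itself; hence no edge leaves the part under one root.\<close>

lemma reach_le: "(u, v) \<in> (parcs graph)\<^sup>* \<Longrightarrow> u \<in> V \<Longrightarrow> r \<in> R \<Longrightarrow> le r u \<Longrightarrow> le r v"
proof (induction rule: rtrancl_induct)
  case (step y z)
  then have "le r y" by blast
  from step(2) show ?case unfolding parcs_graph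
  proof
    assume "(y, z) \<in> up"
    then show ?thesis
      using \<open>le r y\<close> le_unfold[of r y] \<open>r \<in> R\<close> by (auto simp: up_iff)
  next
    assume "(y, z) \<in> up\<inverse>"
    then show ?thesis using \<open>le r y\<close> le_par le_trans by (auto simp: up_iff)
  qed
qed

lemma le_reach: "le u v \<Longrightarrow> (u, v) \<in> (parcs graph)\<^sup>*"
proof -
  assume "le u v"
  then have "(u, v) \<in> (up\<inverse>)\<^sup>*" by (simp add: le_def rtrancl_converse)
  moreover have "(up\<inverse>)\<^sup>* \<subseteq> (parcs graph)\<^sup>*" by (rule rtrancl_mono) (auto simp: parcs_graph)
  ultimately show ?thesis by blast
qed

lemma rooted_forest_graph: "rooted_forest graph R"
  unfolding rooted_forest_def
proof (intro conjI ballI)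
  fix v assume "v \<in> pverts graph"
  then have v: "v \<in> V" by simp
  then obtain r where r: "r \<in> R" "le r v" using ex_root by blast
  show "\<exists>!r. r \<in> R \<and> r \<rightarrow>\<^sup>*\<^bsub>with_proj graph\<^esub> v"
  proof (rule ex1I[of _ r])
    show "r \<in> R \<and> r \<rightarrow>\<^sup>*\<^bsub>with_proj graph\<^esub> v"
      using r v R_sub le_reach by (auto simp: reachable_iff pair_graph_graph)
    fix r' assume r': "r' \<in> R \<and> r' \<rightarrow>\<^sup>*\<^bsub>with_proj graph\<^esub> v"
    then have "le r' v"
      using reach_le[of r' v r'] R_sub le_refl by (auto simp: reachable_iff pair_graph_graph)
    with r r' show "r' = r" using root_unique[of r' r v] by simp
  qed
qed (use R_sub ugraph_forest_graph in auto)

end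

lemma vpath_mono:
  assumes "vpath p (with_proj H)" "pverts H \<subseteq> pverts F" "parcs H \<subseteq> parcs F"
  shows "vpath p (with_proj F)"
  using assms by (auto simp: vpath_def vwalk_def)

text \<open>The distance from the set of roots serves as \<open>d\<close>, and a neighbour that is
  closer serves as parent. No other edges exist, because one outside the parent edges would close a
  cycle with the path that parent edges provide between its ends.\<close>

lemma rooted_forest_imp_parent_forest:
  assumes "rooted_forest F R"
  obtains par d where "parent_forest (pverts F) R par d" "F = parent_forest.graph (pverts F) R par"
proof -
  have F: "ugraph_forest F" "R \<subseteq> pverts F"
    and uniq: "\<And>v. v \<in> pverts F \<Longrightarrow> \<exists>!r. r \<in> R \<and> r \<rightarrow>\<^sup>*\<^bsub>with_proj F\<^esub> v"
    using assms by (auto simp: rooted_forest_def)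
  then have pg: "pair_graph F" by (simp add: ugraph_forest_def)
  then have fin: "finite (pverts F)" and arcs: "parcs F \<subseteq> pverts F \<times> pverts F"
    and sym: "sym (parcs F)" and irr: "irrefl (parcs F)"
    by (auto simp: pair_graph_iff)
  let ?reach = "\<lambda>(n :: nat) v. \<exists>r\<in>R. (r, v) \<in> parcs F ^^ n"
  define d where "d v = (LEAST n. ?reach n v)" for v
  have ex: "\<exists>n. ?reach n v" if "v \<in> pverts F" for v
    using uniq[OF that] by (force simp: reachable_iff pg rtrancl_power)
  have dI: "?reach (d v) v" if "v \<in> pverts F" for v
    unfolding d_def using LeastI_ex[OF ex[OF that]] .
  have d_le: "d v \<le> n" if "?reach n v" for v n
    unfolding d_def using that by (rule Least_le)
  have "\<exists>u\<in>pverts F. (u, v) \<in> parcs F \<and> d u < d v" if v: "v \<in> pverts F - R" for v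
  proof -
    obtain r where r: "r \<in> R" "(r, v) \<in> parcs F ^^ d v" using dI v by blast
    with v obtain n where n: "d v = Suc n" by (cases "d v") auto
    with r obtain u where u: "(r, u) \<in> parcs F ^^ n" "(u, v) \<in> parcs F" by auto
    have "d u \<le> n" by (rule d_le) (use r(1) u(1) in blast)
    with n u(2) arcs show ?thesis by (intro bexI[of _ u]) auto
  qed
  then obtain par where par: "\<And>v. v \<in> pverts F - R \<Longrightarrow>
      par v \<in> pverts F \<and> (par v, v) \<in> parcs F \<and> d (par v) < d v" by metis
  interpret P: parent_forest "pverts F" R par d
    using fin F par by unfold_locales auto
  have sub: "parcs P.graph \<subseteq> parcs F"
    using par sym by (auto simp: P.parcs_graph P.up_iff sym_def)
  have "parcs F \<subseteq> parcs P.graph"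
  proof (rule subrelI, rule ccontr)
    fix u v assume uv: "(u, v) \<in> parcs F" "(u, v) \<notin> parcs P.graph"
    then have in_F: "u \<in> pverts F" "v \<in> pverts F" using arcs by auto
    obtain r s where rs: "r \<in> R" "P.le r u" "s \<in> R" "P.le s v"
      using P.ex_root in_F by meson
    then have paths: "(r, u) \<in> (parcs P.graph)\<^sup>*" "(s, v) \<in> (parcs P.graph)\<^sup>*"
      using P.le_reach by auto
    then have paths_F: "(r, u) \<in> (parcs F)\<^sup>*" "(s, v) \<in> (parcs F)\<^sup>*"
      using rtrancl_mono[OF sub] by auto
    then have "(r, v) \<in> (parcs F)\<^sup>*" using uv by (meson rtrancl.rtrancl_into_rtrancl)
    \<comment> \<open>The edge puts both ends into one component, which has only one root.\<close>
    then have "r = s" using uniq[OF in_F(2)] rs(1,3) paths_F in_F F(2)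
      by (auto simp: reachable_iff pg)
    moreover have "sym ((parcs P.graph)\<^sup>*)"
      by (rule sym_rtrancl) (auto simp: P.parcs_graph sym_def)
    ultimately have "(v, u) \<in> (parcs P.graph)\<^sup>*"
      using paths by (meson rtrancl_trans symD)
    then have "v \<rightarrow>\<^sup>*\<^bsub>with_proj P.graph\<^esub> u"
      using in_F by (simp add: reachable_iff P.pair_graph_graph)
    then obtain p where p: "vpath p (with_proj P.graph)" "hd p = v" "last p = u"
      using P.G.reachable_vpath_conv by auto
    \<comment> \<open>A path of one vertex would make the edge a loop, a path of two would make it a
      parent edge.\<close>
    have "3 \<le> length p"
    proof (rule ccontr)
      assume "\<not> 3 \<le> length p"
      moreover have "p \<noteq> []" using p by (auto simp: vpath_def vwalk_def)
      ultimately consider x where "p = [x]" | x y where "p = [x, y]"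
        by (cases p; cases "tl p"; cases "tl (tl p)") auto
      then show False
      proof cases
        case 1
        with p uv irr show False by (auto simp: irrefl_def)
      next
        case 2
        with p have "(v, u) \<in> parcs P.graph" by (auto simp: vpath_def vwalk_def)
        with uv show False by (auto simp: P.parcs_graph)
      qed
    qed
    moreover have "vpath p (with_proj F)" using vpath_mono[OF p(1)] sub by simp
    ultimately have "ugraph_cycle F p" using uv p by (simp add: ugraph_cycle_def)
    with F show False by (auto simp: ugraph_forest_def)
  qed
  with sub have "F = P.graph" by (intro pair_pre_digraph.equality) auto
  with that P.parent_forest_axioms show ?thesis by blast
qed

section \<open>Rooted trees\<close>

lemma rooted_tree_imp_rooted_forest:
  assumes "rooted_tree T r"
  shows "rooted_forest T {r}"
proof -
  have T: "ugraph_forest T" "connected (with_proj T)" "r \<in> pverts T"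
    using assms by (auto simp: rooted_tree_def ugraph_tree_def)
  then have pg: "pair_graph T" by (simp add: ugraph_forest_def)
  then show ?thesis
    using T by (auto simp: rooted_forest_def reachable_iff connected_iff)
qed

locale parent_tree = parent_forest V "{r}" par d
  for V :: "'a set" and r par d
begin

lemma r_in: "r \<in> V"
  using R_sub by simp

lemma root_le: "v \<in> V \<Longrightarrow> le r v"
  using ex_root by blast

lemma on_path_tree: "on_path graph r t v \<longleftrightarrow> le t v"
  using on_path_iff[of r t v] root_le le_inD by blast

lemma children_graph: "children graph r t = {s \<in> V - {r}. par s = t}"
  using not_le_par le_par by (auto simp: children_def on_path_tree parcs_graph up_iff)

lemma rooted_tree_graph: "rooted_tree graph r"
  unfolding rooted_tree_def ugraph_tree_def
proof (intro conjI)
  have "(u, v) \<in> (parcs graph)\<^sup>*" if "u \<in> V" "v \<in> V" for u v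
  proof -
    have "(r, u) \<in> (parcs graph)\<^sup>*" "(r, v) \<in> (parcs graph)\<^sup>*"
      using that root_le le_reach by auto
    moreover have "sym ((parcs graph)\<^sup>*)"
      by (rule sym_rtrancl) (auto simp: parcs_graph sym_def)
    ultimately show ?thesis by (meson rtrancl_trans symD)
  qed
  then show "connected (with_proj graph)"
    using r_in by (auto simp: connected_iff pair_graph_graph)
qed (auto simp: ugraph_forest_graph r_in)

text \<open>The only edge that leaves the subtree under \<open>t\<close> joins \<open>t\<close> to
  its parent, so a connected set with members on both sides contains both ends of that edge.\<close>

lemma connected_crossing:
  assumes "connected (with_proj graph \<restriction> B)" "x \<in> B" "le t x" "y \<in> B" "\<not> le t y"
  shows "t \<in> B \<and> t \<in> V - {r} \<and> par t \<in> B"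
proof -
  have "(x, y) \<in> (parcs graph \<inter> B \<times> B)\<^sup>*"
    using assms by (auto simp: connected_induced_iff pair_graph_graph)
  then obtain a b where ab: "(a, b) \<in> parcs graph \<inter> B \<times> B" "le t a" "\<not> le t b"
    using rtrancl_crossing[of x y _ "{z. le t z}"] assms by blast
  have "(b, a) \<notin> up"
    using ab le_par[of b] le_trans[of t a b] by (auto simp: up_iff)
  with ab have a: "a \<in> V - {r}" "b = par a" by (auto simp: parcs_graph up_iff)
  with ab have "a = t" using le_unfold[of t a] by auto
  with ab a show ?thesis by auto
qed

text \<open>Climbing from parent to parent stays in \<open>B\<close> and can stop only at
  \<open>b0\<close>, and it must stop because \<open>d\<close> drops.\<close>

lemma connectedI:
  assumes "b0 \<in> B" "B \<subseteq> V" and step: "\<And>b. b \<in> B \<Longrightarrow> b \<noteq> b0 \<Longrightarrow> b \<noteq> r \<and> par b \<in> B"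
  shows "connected (with_proj graph \<restriction> B)"
proof -
  have *: "(b0, b) \<in> (parcs graph \<inter> B \<times> B)\<^sup>*" if "b \<in> B" for b
    using that
  proof (induction "d b" arbitrary: b rule: less_induct)
    case less
    show ?case
    proof (cases "b = b0")
      case False
      with less.prems step have b: "b \<noteq> r" "par b \<in> B" by auto
      with less.prems assms have "d (par b) < d b" using par_d by auto
      then have "(b0, par b) \<in> (parcs graph \<inter> B \<times> B)\<^sup>*" using less b by blast
      moreover have "(par b, b) \<in> parcs graph \<inter> B \<times> B"
        using b less.prems assms by (auto simp: parcs_graph up_iff)
      ultimately show ?thesis by (rule rtrancl_into_rtrancl)
    qed simp
  qed
  have "sym ((parcs graph \<inter> B \<times> B)\<^sup>*)"
    by (rule sym_rtrancl) (auto simp: parcs_graph sym_def)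
  then have "(u, v) \<in> (parcs graph \<inter> B \<times> B)\<^sup>*" if "u \<in> B" "v \<in> B" for u v
    using *[OF that(1)] *[OF that(2)] by (meson rtrancl_trans symD)
  then show ?thesis
    using assms(1) by (auto simp: connected_induced_iff pair_graph_graph)
qed

end

lemma rooted_tree_imp_parent_tree:
  assumes "rooted_tree T r"
  obtains par d where "parent_tree (pverts T) r par d" "T = parent_forest.graph (pverts T) {r} par"
  using rooted_forest_imp_parent_forest[OF rooted_tree_imp_rooted_forest[OF assms]]
  unfolding parent_tree_def by metis

section \<open>Forest orders\<close>

text \<open>The ancestor relation without a graph: partial orders in which the predecessors of each
  element form a chain. \<open>ex_parent_forest\<close> recovers a parent function from it.\<close>

locale forest_order =
  fixes V :: "'a set" and le :: "'a \<Rightarrow> 'a \<Rightarrow> bool"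
  assumes finite_V: "finite V"
    and in_V: "le u v \<Longrightarrow> u \<in> V \<and> v \<in> V"
    and refl: "v \<in> V \<Longrightarrow> le v v"
    and trans: "le u v \<Longrightarrow> le v w \<Longrightarrow> le u w"
    and antisym: "le u v \<Longrightarrow> le v u \<Longrightarrow> u = v"
    and chain: "le u w \<Longrightarrow> le v w \<Longrightarrow> le u v \<or> le v u"

lemma (in parent_forest) forest_order_le: "forest_order V le"
  using finite_V le_inD le_refl le_trans le_antisym le_chain by unfold_locales blast+

context forest_order
begin

lemma finite_below: "finite {u. le u v}"
  by (rule finite_subset[OF _ finite_V]) (use in_V in blast)

lemma card_below_mono: "le u v \<Longrightarrow> u \<noteq> v \<Longrightarrow> card {w. le w u} < card {w. le w v}"
proof -
  assume *: "le u v" "u \<noteq> v"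
  then have "{w. le w u} \<subseteq> {w. le w v}" using trans by blast
  moreover have "v \<in> {w. le w v} - {w. le w u}"
    using * refl in_V antisym by blast
  ultimately show ?thesis by (intro psubset_card_mono finite_below) blast
qed

text \<open>The number of predecessors is the measure. The strict predecessors of \<open>v\<close>
  form a chain, so one with the most predecessors is the greatest of them, and this is the
  parent.\<close>

lemma ex_parent_forest:
  obtains R par d where "parent_forest V R par d" "parent_forest.le V R par = le"
proof -
  define d where "d v = card {u. le u v}" for v
  define R where "R = {v \<in> V. \<forall>u. le u v \<longrightarrow> u = v}"
  have d_mono: "d u < d v" if "le u v" "u \<noteq> v" for u v
    unfolding d_def using card_below_mono that by blast
  have "\<exists>u. le u v \<and> u \<noteq> v \<and> (\<forall>w. le w v \<longrightarrow> w \<noteq> v \<longrightarrow> le w u)" if v: "v \<in> V - R" for v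
  proof -
    let ?S = "{u. le u v \<and> u \<noteq> v}"
    have fin: "finite (d ` ?S)" using finite_below[of v] by (auto intro: finite_subset)
    have "d ` ?S \<noteq> {}" using v by (auto simp: R_def)
    then obtain u where u: "u \<in> ?S" "d u = Max (d ` ?S)" using Max_in[OF fin] by auto
    have "le w u" if w: "le w v" "w \<noteq> v" for w
    proof (rule ccontr)
      assume "\<not> le w u"
      then have "le u w" "u \<noteq> w" using chain[of w v u] refl in_V u w by auto
      then have "d u < d w" by (rule d_mono)
      moreover have "d w \<le> d u" unfolding u(2) using fin w by (intro Max_ge) auto
      ultimately show False by simp
    qed
    with u show ?thesis by blast
  qed
  then obtain par where par: "\<And>v. v \<in> V - R \<Longrightarrow>
      le (par v) v \<and> par v \<noteq> v \<and> (\<forall>w. le w v \<longrightarrow> w \<noteq> v \<longrightarrow> le w (par v))" by metis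
  interpret P: parent_forest V R par d
  proof
    show "R \<subseteq> V" by (auto simp: R_def)
    show "par v \<in> V" "d (par v) < d v" if "v \<in> V - R" for v
      using par[OF that] d_mono in_V by blast+
  qed (rule finite_V)
  have "P.le u v \<longleftrightarrow> le u v" if "v \<in> V" for u v
    using that
  proof (induction v rule: P.par_induct)
    case (root r)
    then show ?case using P.le_root[of r u] refl by (auto simp: R_def)
  next
    case (step v)
    then have "le u (par v) \<longleftrightarrow> le u v \<and> u \<noteq> v"
      using par[of v] trans antisym by blast
    then show ?case using P.le_unfold[of u v] step refl by auto
  qed
  then have "P.le = le" using P.le_inD in_V by (intro ext) blast
  with that P.parent_forest_axioms show ?thesis by blast
qed

end

section \<open>Condition (3) as a property of the ancestor order\<close>

definition pebbled_order :: "nat \<Rightarrow> nat \<Rightarrow> 'a pair_pre_digraph \<Rightarrow> ('a \<Rightarrow> 'a \<Rightarrow> bool) \<Rightarrow> ('a \<Rightarrow> nat) \<Rightarrow> bool"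
  where "pebbled_order k q G le p \<longleftrightarrow> forest_order (pverts G) le \<and>
    p ` pverts G \<subseteq> {1..k} \<and>
    (\<forall>u v. (u, v) \<in> parcs G \<longrightarrow> le u v \<or> le v u) \<and>
    (\<forall>u v w. (u, v) \<in> parcs G \<longrightarrow> le u w \<longrightarrow> u \<noteq> w \<longrightarrow> le w v \<longrightarrow> p w \<noteq> p u) \<and>
    (\<forall>v\<in>pverts G. card {u. le u v} \<le> q)"

text \<open>Every nonempty chain lies below its member of largest \<open>d\<close>, and the
  predecessors of one vertex are themselves a chain. The empty chain keeps the maximum defined when
  there are no vertices.\<close>

lemma (in parent_forest) forest_height_le_iff:
  "forest_height graph R \<le> q \<longleftrightarrow> (\<forall>v\<in>V. card {u. le u v} \<le> q)"
proof -
  interpret O: forest_order V le by (rule forest_order_le)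
  let ?C = "{C. C \<subseteq> V \<and> (\<forall>u\<in>C. \<forall>v\<in>C. le u v \<or> le v u)}"
  have "finite ?C" by (rule finite_subset[of _ "Pow V"]) (auto simp: finite_V)
  moreover have "{} \<in> ?C" by simp
  ultimately have "forest_height graph R \<le> q \<longleftrightarrow> (\<forall>C\<in>?C. card C \<le> q)"
    unfolding forest_height_def forest_le_graph pverts_graph by (subst Max_le_iff) blast+
  also have "\<dots> \<longleftrightarrow> (\<forall>v\<in>V. card {u. le u v} \<le> q)"
  proof (intro iffI ballI)
    fix v assume "\<forall>C\<in>?C. card C \<le> q" "v \<in> V"
    moreover have "{u. le u v} \<in> ?C" using le_inD le_chain by blast
    ultimately show "card {u. le u v} \<le> q" by blast
  next
    fix C assume *: "\<forall>v\<in>V. card {u. le u v} \<le> q" and C: "C \<in> ?C"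
    show "card C \<le> q"
    proof (cases "C = {}")
      case False
      have fin: "finite (d ` C)" using C finite_V finite_subset by auto
      then have "Max (d ` C) \<in> d ` C" using False by (intro Max_in) auto
      then obtain v where v: "v \<in> C" "d v = Max (d ` C)" by (metis imageE)
      have "le u v" if u: "u \<in> C" for u
      proof (rule ccontr)
        assume n: "\<not> le u v"
        then have "le v u" using C u v by blast
        then have "d v < d u" using n le_d[of v u] le_refl[of u] C u by blast
        moreover have "d u \<le> d v" unfolding v(2) using fin u by (intro Max_ge) auto
        ultimately show False by simp
      qed
      then have "card C \<le> card {u. le u v}" by (intro card_mono O.finite_below) blast
      with * v C show ?thesis by force
    qed simp
  qed
  finally show ?thesis .
qed

text \<open>\<open>pebbled_order\<close> states the pebble condition without
  \<open>u \<noteq> v\<close> and \<open>le u v\<close>, since \<open>le u w\<close>,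
  \<open>u \<noteq> w\<close> and \<open>le w v\<close> imply both.\<close>

lemma pebble_forest_class_iff:
  assumes "pair_graph G"
  shows "G \<in> pebble_forest_class k q \<longleftrightarrow> (\<exists>le p. pebbled_order k q G le p)"
proof
  assume "G \<in> pebble_forest_class k q"
  then obtain F R p where c: "pebble_forest_cover k G F R p" and h: "forest_height F R \<le> q"
    by (auto simp: pebble_forest_class_def)
  then have F: "rooted_forest F R" "pverts F = pverts G" by (auto simp: pebble_forest_cover_def)
  obtain par d where P: "parent_forest (pverts G) R par d"
      "F = parent_forest.graph (pverts G) R par"
    using rooted_forest_imp_parent_forest[OF F(1)] unfolding F(2) by blast
  interpret P: parent_forest "pverts G" R par d by (rule P)
  have "pebbled_order k q G P.le p"
    unfolding pebbled_order_def
  proof (intro conjI allI impI)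
    show "\<forall>v\<in>pverts G. card {u. P.le u v} \<le> q" using h P(2) P.forest_height_le_iff by simp
    show "p ` pverts G \<subseteq> {1..k}" using c by (auto simp: pebble_forest_cover_def)
    fix u v assume uv: "(u, v) \<in> parcs G"
    then show "P.le u v \<or> P.le v u"
      using c P(2) by (auto simp: pebble_forest_cover_def P.forest_le_graph)
    fix w assume w: "P.le u w" "u \<noteq> w" "P.le w v"
    moreover from this have "P.le u v" "u \<noteq> v" using P.le_trans P.le_antisym by blast+
    ultimately show "p w \<noteq> p u"
      using c uv P(2) by (auto simp: pebble_forest_cover_def P.forest_le_graph forest_less_def)
  qed (rule P.forest_order_le)
  then show "\<exists>le p. pebbled_order k q G le p" by blast
next
  assume "\<exists>le p. pebbled_order k q G le p"
  then obtain le p where p: "pebbled_order k q G le p" by blast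
  then interpret O: forest_order "pverts G" le by (simp add: pebbled_order_def)
  obtain R par d where P: "parent_forest (pverts G) R par d" "parent_forest.le (pverts G) R par = le"
    using O.ex_parent_forest by blast
  interpret P: parent_forest "pverts G" R par d by (rule P)
  have "pebble_forest_cover k G P.graph R p"
    using p P.rooted_forest_graph P(2)
    by (auto simp: pebble_forest_cover_def pebbled_order_def P.forest_le_graph forest_less_def)
  moreover have "forest_height P.graph R \<le> q"
    using p P(2) by (simp add: pebbled_order_def P.forest_height_le_iff)
  ultimately show "G \<in> pebble_forest_class k q"
    using assms by (auto simp: pebble_forest_class_def)
qed

section \<open>Renaming vertices along an injection\<close>

definition map_pair_graph :: "('a \<Rightarrow> 'b) \<Rightarrow> 'a pair_pre_digraph \<Rightarrow> 'b pair_pre_digraph" where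
  "map_pair_graph f G = \<lparr>pverts = f ` pverts G, parcs = map_prod f f ` parcs G\<rparr>"

lemma pair_graph_map:
  assumes "pair_graph G" "inj_on f (pverts G)"
  shows "pair_graph (map_pair_graph f G)"
  using assms by (auto simp: pair_graph_iff map_pair_graph_def sym_def irrefl_def inj_on_def) blast+

text \<open>The construction tree is built over natural numbers, so a pebbled order of
  \<open>G\<close> has to be carried along a renaming.\<close>

lemma pebbled_order_map:
  assumes "pair_graph G" and inj: "inj_on f (pverts G)" and p: "pebbled_order k q G le p"
  shows "\<exists>le' p'. pebbled_order k q (map_pair_graph f G) le' p'"
proof -
  let ?V = "pverts G"
  interpret O: forest_order ?V le using p by (simp add: pebbled_order_def)
  define g where "g = inv_into ?V f"
  have g: "g (f v) = v" if "v \<in> ?V" for v using inj that by (simp add: g_def)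
  define le' where "le' a b \<longleftrightarrow> a \<in> f ` ?V \<and> b \<in> f ` ?V \<and> le (g a) (g b)" for a b
  have le': "le' (f u) (f v) \<longleftrightarrow> le u v" if "u \<in> ?V" "v \<in> ?V" for u v
    using that g by (auto simp: le'_def)
  have arcs: "parcs G \<subseteq> ?V \<times> ?V" using assms by (simp add: pair_graph_iff)
  have "pebbled_order k q (map_pair_graph f G) le' (p \<circ> g)"
    unfolding pebbled_order_def
  proof (intro conjI allI impI ballI)
    show "forest_order (pverts (map_pair_graph f G)) le'"
    proof
      fix u v w
      assume "le' u w" "le' v w"
      then show "le' u v \<or> le' v u" using O.chain by (auto simp: le'_def g)
    qed (use O.finite_V O.refl O.trans O.antisym g in
        \<open>auto simp: map_pair_graph_def le'_def dest: O.antisym intro: O.trans\<close>)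
    show "(p \<circ> g) ` pverts (map_pair_graph f G) \<subseteq> {1..k}"
      using p g by (auto simp: map_pair_graph_def pebbled_order_def)
  next
    fix a b assume "(a, b) \<in> parcs (map_pair_graph f G)"
    then obtain u v where uv: "(u, v) \<in> parcs G" "a = f u" "b = f v"
      by (auto simp: map_pair_graph_def)
    with arcs have V: "u \<in> ?V" "v \<in> ?V" by auto
    show "le' a b \<or> le' b a"
      using p uv V le' by (auto simp: pebbled_order_def)
    fix c assume c: "le' a c" "a \<noteq> c" "le' c b"
    then obtain w where w: "w \<in> ?V" "c = f w" by (auto simp: le'_def)
    with c uv V le' have "le u w" "u \<noteq> w" "le w v" by auto
    then have "p w \<noteq> p u" using p uv(1) unfolding pebbled_order_def by blast
    then show "(p \<circ> g) c \<noteq> (p \<circ> g) a" using w uv V g by simp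
  next
    fix b assume "b \<in> pverts (map_pair_graph f G)"
    then obtain v where v: "v \<in> ?V" "b = f v" by (auto simp: map_pair_graph_def)
    have "{a. le' a b} = f ` {u. le u v}"
      using v le' O.in_V g by (auto simp: le'_def image_iff)
    then have "card {a. le' a b} \<le> card {u. le u v}"
      using card_image_le[OF O.finite_below] by simp
    also have "\<dots> \<le> q" using p v by (auto simp: pebbled_order_def)
    finally show "card {a. le' a b} \<le> q" .
  qed
  then show ?thesis by blast
qed

section \<open>From tree decompositions to pebbled orders\<close>

text \<open>All members of \<open>N v\<close> precede \<open>v\<close> and there are fewer than
  \<open>k\<close> of them, so recursion along the order always finds a free colour.\<close>

lemma (in forest_order) greedy_colouring:
  assumes "\<And>v. v \<in> V \<Longrightarrow> N v \<subseteq> {u. le u v \<and> u \<noteq> v} \<and> card (N v) < k"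
  shows "\<exists>p. \<forall>v\<in>V. p v \<in> {1..k} \<and> p v \<notin> p ` N v"
proof -
  let ?r = "{(u, v). le u v \<and> u \<noteq> v}"
  let ?P = "\<lambda>p v c. v \<in> V \<longrightarrow> c \<in> {1..k} \<and> c \<notin> p ` N v"
  have "?r \<subseteq> measure (\<lambda>v. card {u. le u v})" using card_below_mono by auto
  then have "wf ?r" by (rule wf_subset[OF wf_measure])
  then have "\<exists>p. \<forall>v. ?P p v (p v)"
  proof (rule dependent_wf_choice[where P = ?P and R = ?r])
    \<comment> \<open>The choice at \<open>v\<close> may depend only on the colours of strict
      predecessors, and \<open>N v\<close> consists of these.\<close>
    fix p p' :: "'a \<Rightarrow> nat" and v :: 'a and c :: nat
    assume eq: "\<And>u. (u, v) \<in> ?r \<Longrightarrow> p u = p' u"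
    have "p ` N v = p' ` N v" if "v \<in> V"
      using assms[OF that] eq by (intro image_cong) auto
    then show "?P p v c = ?P p' v c" by auto
  next
    fix v :: 'a and p :: "'a \<Rightarrow> nat"
    assume "\<And>u. (u, v) \<in> ?r \<Longrightarrow> ?P p u (p u)"
    show "\<exists>c. ?P p v c"
    proof (cases "v \<in> V")
      case True
      have "finite (N v)" 
        using assms[OF True] finite_below[of v] by (auto intro: finite_subset)
      then have "card (p ` N v) < card {1..k}"
        using assms[OF True] card_image_le[of "N v" p] by simp
      then have "\<not> {1..k} \<subseteq> p ` N v" using card_mono \<open>finite (N v)\<close> by (metis finite_imageI leD)
      then show ?thesis by blast
    qed simp
  qed
  then show ?thesis by blast
qed

lemma tree_decomposition_imp_pebbled_order:
  assumes G: "pair_graph G" and td: "tree_decomposition G T \<beta>"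
    and width: "td_width T \<beta> \<le> int k - 1" and depth: "td_depth T \<beta> \<le> q"
  shows "\<exists>le p. pebbled_order k q G le p"
proof -
  let ?V = "pverts G"
  have fin_G: "finite ?V" and arcs: "parcs G \<subseteq> ?V \<times> ?V" using G by (auto simp: pair_graph_iff)
  have tree: "ugraph_tree T" and bag_sub: "\<And>t. t \<in> pverts T \<Longrightarrow> \<beta> t \<subseteq> ?V"
    and cover: "\<And>v. v \<in> ?V \<Longrightarrow> \<exists>t\<in>pverts T. v \<in> \<beta> t"
    and edges: "\<And>u v. (u, v) \<in> parcs G \<Longrightarrow> \<exists>t\<in>pverts T. u \<in> \<beta> t \<and> v \<in> \<beta> t"
    and conn: "\<And>v. v \<in> ?V \<Longrightarrow> connected (with_proj T \<restriction> {t \<in> pverts T. v \<in> \<beta> t})"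
    using td by (auto simp: tree_decomposition_def)
  have pg: "pair_graph T" using tree by (simp add: ugraph_tree_def ugraph_forest_def)
  then have fin: "finite (pverts T)" by (simp add: pair_graph_iff)
  have ne: "pverts T \<noteq> {}" using tree pg by (simp add: ugraph_tree_def connected_iff)
  have bag_card: "card (\<beta> t) \<le> k" if "t \<in> pverts T" for t
  proof -
    have "card (\<beta> t) \<le> Max ((\<lambda>t. card (\<beta> t)) ` pverts T)"
      using fin that by (intro Max_ge) auto
    with width show ?thesis by (simp add: td_width_def)
  qed
  let ?depth = "\<lambda>r. Max ((\<lambda>v. card (\<Union>t\<in>{t. on_path T r t v}. \<beta> t)) ` pverts T)"
  \<comment> \<open>The depth is a minimum over all roots; the tree is rooted at \<open>r\<close>
    where it is attained.\<close>
  have "Min (?depth ` pverts T) \<in> ?depth ` pverts T" using fin ne by (intro Min_in) auto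
  then obtain r where r: "r \<in> pverts T" "?depth r \<le> q"
    using depth unfolding td_depth_def by fastforce
  have path_card: "card (\<Union>t\<in>{t. on_path T r t v}. \<beta> t) \<le> q" if "v \<in> pverts T" for v
  proof -
    have "card (\<Union>t\<in>{t. on_path T r t v}. \<beta> t) \<le> ?depth r"
      using fin that by (intro Max_ge) auto
    with r show ?thesis by simp
  qed
  have "rooted_tree T r" using tree r by (simp add: rooted_tree_def)
  then obtain par d where P: "parent_tree (pverts T) r par d"
      "T = parent_forest.graph (pverts T) {r} par"
    by (rule rooted_tree_imp_parent_tree)
  interpret P: parent_tree "pverts T" r par d by (rule P)
  define B where "B v = {t \<in> pverts T. v \<in> \<beta> t}" for v
  have connB: "connected (with_proj P.graph \<restriction> B v)" if "v \<in> ?V" for v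
    using conn[OF that] P(2) by (simp add: B_def)
  \<comment> \<open>A node of \<open>B v\<close> with least \<open>d\<close> lies above all others:
    otherwise connectedness would force its parent, which has smaller \<open>d\<close>, into
    \<open>B v\<close>.\<close>
  have "\<exists>t\<in>B v. \<forall>s\<in>B v. P.le t s" if v: "v \<in> ?V" for v
  proof -
    have finB: "finite (d ` B v)" using fin by (simp add: B_def)
    moreover have "B v \<noteq> {}" using cover[OF v] by (auto simp: B_def)
    ultimately have "Min (d ` B v) \<in> d ` B v" by (intro Min_in) auto
    then obtain t where t: "t \<in> B v" "d t = Min (d ` B v)" by (metis imageE)
    have "P.le t s" if s: "s \<in> B v" for s
    proof (rule ccontr)
      assume "\<not> P.le t s"
      moreover have "P.le t t" using t by (simp add: B_def P.le_refl)
      ultimately have *: "t \<in> pverts T - {r}" "par t \<in> B v"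
        using P.connected_crossing[OF connB[OF v] t(1) _ s] by auto
      then have "d t \<le> d (par t)" unfolding t(2) using finB by (intro Min_le) auto
      with P.par_d[OF *(1)] show False by simp
    qed
    with t show ?thesis by blast
  qed
  then obtain top where top: "\<And>v. v \<in> ?V \<Longrightarrow> top v \<in> B v"
    and top_le: "\<And>v s. v \<in> ?V \<Longrightarrow> s \<in> B v \<Longrightarrow> P.le (top v) s" by metis
  \<comment> \<open>Connectedness keeps \<open>v\<close> in every bag between its top node and any
    other node of \<open>B v\<close>.\<close>
  have between: "s \<in> B v" if "v \<in> ?V" "t \<in> B v" "P.le s t" "P.le (top v) s" for v s t
  proof (cases "P.le s (top v)")
    case True
    then show ?thesis using that top P.le_antisym by metis
  next
    case False
    then show ?thesis using P.connected_crossing[OF connB that(2,3)] top that by blast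
  qed
  obtain idx where idx: "bij_betw idx ?V {0..<card ?V}"
    using ex_bij_betw_finite_nat[OF fin_G] by blast
  define le where "le u v \<longleftrightarrow> u \<in> ?V \<and> v \<in> ?V \<and> P.le (top u) (top v) \<and>
      (top u = top v \<longrightarrow> idx u \<le> idx v)" for u v
  have topV: "top v \<in> pverts T" if "v \<in> ?V" for v using top[OF that] by (simp add: B_def)
  have comparable: "le u v \<or> le v u"
    if "u \<in> ?V" "v \<in> ?V" "P.le (top u) t" "P.le (top v) t" for u v t
    using P.le_chain[OF that(3,4)] that(1,2) P.le_antisym[of "top u" "top v"] nat_le_linear
    unfolding le_def by metis
  interpret O: forest_order ?V le
  proof
    show "finite ?V" by (rule fin_G)
    show "u \<in> ?V \<and> v \<in> ?V" if "le u v" for u v using that by (simp add: le_def)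
    show "le v v" if "v \<in> ?V" for v using that topV P.le_refl by (simp add: le_def)
    show "le u w" if "le u v" "le v w" for u v w
    proof -
      have "top u = top v \<and> top v = top w" if "top u = top w"
        using \<open>le u v\<close> \<open>le v w\<close> that P.le_antisym unfolding le_def by metis
      with that show ?thesis unfolding le_def using P.le_trans by fastforce
    qed
    show "u = v" if "le u v" "le v u" for u v
    proof -
      have "top u = top v" using that P.le_antisym unfolding le_def by blast
      with that have "idx u = idx v" unfolding le_def by simp
      then show ?thesis using idx that unfolding le_def bij_betw_def inj_on_def by blast
    qed
    show "le u v \<or> le v u" if "le u w" "le v w" for u v w
      using that comparable[of u v "top w"] unfolding le_def by blast
  qed
  \<comment> \<open>The vertices whose colours are forbidden at \<open>v\<close>. The top bag of
    \<open>v\<close> contains \<open>v\<close> itself, which leaves at most \<open>k - 1\<close> of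
    them.\<close>
  define N where "N v = {u \<in> \<beta> (top v). le u v \<and> u \<noteq> v}" for v
  have "N v \<subseteq> {u. le u v \<and> u \<noteq> v} \<and> card (N v) < k" if v: "v \<in> ?V" for v
  proof
    have "v \<in> \<beta> (top v)" using top[OF v] by (simp add: B_def)
    then have "N v \<subset> \<beta> (top v)" by (auto simp: N_def)
    moreover have "finite (\<beta> (top v))" using bag_sub topV v fin_G finite_subset by blast
    ultimately have "card (N v) < card (\<beta> (top v))" by (rule psubset_card_mono[rotated])
    then show "card (N v) < k" using bag_card[OF topV[OF v]] by simp
  qed (auto simp: N_def)
  then obtain p where p: "\<And>v. v \<in> ?V \<Longrightarrow> p v \<in> {1..k} \<and> p v \<notin> p ` N v"
    using O.greedy_colouring[of N k] by blast
  have "pebbled_order k q G le p"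
    unfolding pebbled_order_def
  proof (intro conjI allI impI ballI)
    show "p ` ?V \<subseteq> {1..k}" using p by blast
  next
    fix u v assume uv: "(u, v) \<in> parcs G"
    with arcs have V: "u \<in> ?V" "v \<in> ?V" by auto
    \<comment> \<open>A bag with both ends lies below both top nodes, and the ancestors of
      \<open>t\<close> form a chain.\<close>
    obtain t where t: "t \<in> B u" "t \<in> B v" using edges[OF uv] by (auto simp: B_def)
    show "le u v \<or> le v u" using comparable[OF V] top_le V t by blast
    fix w assume w: "le u w" "u \<noteq> w" "le w v"
    then have "w \<in> ?V" "P.le (top u) (top w)" "P.le (top w) t"
      using P.le_trans top_le[OF V(2) t(2)] unfolding le_def by blast+
    \<comment> \<open>The top of \<open>w\<close> lies between the top of \<open>u\<close> and the
      common bag, so \<open>u\<close> is still in the top bag of \<open>w\<close> and its colour is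
      forbidden there.\<close>
    then have "top w \<in> B u" using between[OF V(1) t(1)] by blast
    then have "u \<in> N w" using w by (simp add: N_def B_def)
    then show "p w \<noteq> p u" using p[OF \<open>w \<in> ?V\<close>] by (metis imageI)
  next
    fix v assume v: "v \<in> ?V"
    \<comment> \<open>Each predecessor of \<open>v\<close> is in its own top bag, and that bag is on
      the path to \<open>top v\<close>.\<close>
    have "{u. le u v} \<subseteq> (\<Union>t\<in>{t. on_path T r t (top v)}. \<beta> t)"
    proof
      fix u assume "u \<in> {u. le u v}"
      then have "u \<in> ?V" "P.le (top u) (top v)" by (auto simp: le_def)
      then have "on_path T r (top u) (top v)" "u \<in> \<beta> (top u)"
        using P.on_path_tree P(2) top[of u] by (auto simp: B_def)
      then show "u \<in> (\<Union>t\<in>{t. on_path T r t (top v)}. \<beta> t)" by blast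
    qed
    moreover have "(\<Union>t\<in>{t. on_path T r t (top v)}. \<beta> t) \<subseteq> ?V"
      using P.on_path_tree P(2) P.le_inD bag_sub by fastforce
    then have "finite (\<Union>t\<in>{t. on_path T r t (top v)}. \<beta> t)" using fin_G finite_subset by blast
    ultimately have "card {u. le u v} \<le> card (\<Union>t\<in>{t. on_path T r t (top v)}. \<beta> t)"
      by (intro card_mono)
    then show "card {u. le u v} \<le> q" using path_card[OF topV[OF v]] by simp
  qed (rule O.forest_order_axioms)
  then show ?thesis by blast
qed

section \<open>From pebbled orders to construction trees\<close>

text \<open>The partial inverse of \<open>p\<close> on \<open>S\<close>: where \<open>p\<close> is
  injective on \<open>S\<close>, each vertex of \<open>S\<close> carries its own pebble as its only
  label.\<close>

definition label_by :: "('a \<Rightarrow> nat) \<Rightarrow> 'a set \<Rightarrow> nat \<rightharpoonup> 'a" where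
  "label_by p S l = (if l \<in> p ` S then Some (inv_into S p l) else None)"

lemma label_by_Some_iff:
  "inj_on p S \<Longrightarrow> label_by p S l = Some u \<longleftrightarrow> u \<in> S \<and> p u = l"
  by (auto simp: label_by_def inj_on_eq_iff)

lemma label_by_None_iff: "label_by p S l = None \<longleftrightarrow> l \<notin> p ` S"
  by (auto simp: label_by_def)

lemma label_by_remove:
  assumes "inj_on p S" "x \<in> S"
  shows "label_by p (S - {x}) = (label_by p S)(p x := None)"
proof
  fix l
  have "inj_on p (S - {x})" using assms(1) by (rule inj_on_diff)
  then have "label_by p (S - {x}) l = Some u \<longleftrightarrow> ((label_by p S)(p x := None)) l = Some u" for u
    using assms by (auto simp: label_by_Some_iff inj_on_eq_iff)
  then show "label_by p (S - {x}) l = ((label_by p S)(p x := None)) l"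
    by (metis not_None_eq)
qed

definition labelled_subgraph ::
  "'a pair_pre_digraph \<Rightarrow> ('a \<Rightarrow> nat) \<Rightarrow> 'a set \<Rightarrow> 'a set \<Rightarrow> 'a lgraph" where
  "labelled_subgraph G p W S =
     \<lparr>lg_graph = \<lparr>pverts = W, parcs = parcs G \<inter> W \<times> W\<rparr>, lg_label = label_by p S\<rparr>"

lemma labelled_subgraph_simps [simp]:
  "pverts (lg_graph (labelled_subgraph G p W S)) = W"
  "parcs (lg_graph (labelled_subgraph G p W S)) = parcs G \<inter> W \<times> W"
  "lg_label (labelled_subgraph G p W S) = label_by p S"
  by (simp_all add: labelled_subgraph_def)

text \<open>All pieces take their labels from one \<open>p\<close> that is injective on the labelled
  vertices, so a common label means copies of the same vertex; and a vertex shared by two pieces is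
  labelled in both. Thus gluing identifies exactly the copies of each vertex, and the product is the
  union of the pieces.\<close>

lemma lgraph_iso_product:
  assumes G: "irrefl (parcs G)" and inj: "inj_on p (\<Union>i\<in>I. S i)" and SW: "\<And>i. i \<in> I \<Longrightarrow> S i \<subseteq> W i"
    and overlap: "\<And>i j x. i \<in> I \<Longrightarrow> j \<in> I \<Longrightarrow> i \<noteq> j \<Longrightarrow> x \<in> W i \<Longrightarrow> x \<in> W j \<Longrightarrow> x \<in> S i"
    and edges: "\<And>u v. (u, v) \<in> parcs G \<Longrightarrow> u \<in> (\<Union>i\<in>I. W i) \<Longrightarrow> v \<in> (\<Union>i\<in>I. W i) \<Longrightarrow>
      \<exists>i\<in>I. u \<in> W i \<and> v \<in> W i"
  shows "lgraph_iso (labelled_subgraph G p (\<Union>i\<in>I. W i) (\<Union>i\<in>I. S i))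
    (lg_product I (\<lambda>i. labelled_subgraph G p (W i) (S i)))" (is "lgraph_iso ?H (lg_product I ?lam)")
proof -
  \<comment> \<open>The class of \<open>x\<close> in the product is the set of all its copies; this
    map is the isomorphism.\<close>
  define f where "f x = {(j, x) | j. j \<in> I \<and> x \<in> W j}" for x
  have injS: "inj_on p (S i)" if "i \<in> I" for i using inj that by (auto simp: inj_on_def)
  have common: "((i, x), (j, y)) \<in> common_label I ?lam \<longleftrightarrow> i \<in> I \<and> j \<in> I \<and> x = y \<and> x \<in> S i \<inter> S j"
    for i x j y
    using inj by (auto simp: common_label_def label_by_Some_iff injS inj_on_def) blast
  have glue: "glue I ?lam (i, x) = f x" if i: "i \<in> I" "x \<in> W i" for i x
  proof (intro set_eqI iffI)
    fix z assume "z \<in> glue I ?lam (i, x)"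
    then have "((i, x), z) \<in> (common_label I ?lam)\<^sup>*" by (simp add: glue_def)
    then show "z \<in> f x"
    proof (induction rule: rtrancl_induct)
      case base
      with i show ?case by (simp add: f_def)
    next
      case (step y z)
      then show ?case using SW by (cases y; cases z) (auto simp: f_def common)
    qed
  next
    fix z assume "z \<in> f x"
    then obtain j where z: "z = (j, x)" and j: "j \<in> I" "x \<in> W j" by (auto simp: f_def)
    \<comment> \<open>Copies in different pieces are both labelled by \<open>overlap\<close>, so one
      step of the relation suffices.\<close>
    have "z = (i, x) \<or> ((i, x), z) \<in> common_label I ?lam"
      unfolding z common using overlap i j by blast
    then show "z \<in> glue I ?lam (i, x)" by (auto simp: glue_def)
  qed
  have f_inj: "x = y" if "x \<in> (\<Union>i\<in>I. W i)" "f x = f y" for x y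
    using that by (auto simp: f_def)
  have verts: "pverts (lg_graph (lg_product I ?lam)) = f ` (\<Union>i\<in>I. W i)"
    using glue by (auto simp: lg_product_def) blast
  have "bij_betw f (\<Union>i\<in>I. W i) (pverts (lg_graph (lg_product I ?lam)))"
    unfolding verts using f_inj by (auto simp: bij_betw_def intro!: inj_onI)
  moreover have "(u, v) \<in> parcs G \<longleftrightarrow> (f u, f v) \<in> parcs (lg_graph (lg_product I ?lam))"
    if uv: "u \<in> (\<Union>i\<in>I. W i)" "v \<in> (\<Union>i\<in>I. W i)" for u v
  proof
    assume e: "(u, v) \<in> parcs G"
    then obtain i where i: "i \<in> I" "u \<in> W i" "v \<in> W i" using edges uv by blast
    have "u \<noteq> v" using e G by (auto simp: irrefl_def)
    then have "f u \<noteq> f v" using f_inj uv by blast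
    then have "(glue I ?lam (i, u), glue I ?lam (i, v)) \<in> parcs (lg_graph (lg_product I ?lam))"
      unfolding glue[OF i(1,2), symmetric] glue[OF i(1,3), symmetric] using i e
      by (simp add: lg_product_def, intro exI[of _ i] exI[of _ u]) (simp, blast)
    then show "(f u, f v) \<in> parcs (lg_graph (lg_product I ?lam))" using glue i by simp
  next
    assume "(f u, f v) \<in> parcs (lg_graph (lg_product I ?lam))"
    then obtain i x y where i: "i \<in> I" "(x, y) \<in> parcs G" "x \<in> W i" "y \<in> W i"
      and "f u = glue I ?lam (i, x)" "f v = glue I ?lam (i, y)" by (auto simp: lg_product_def)
    then have "f u = f x" "f v = f y" using glue by simp_all
    then show "(u, v) \<in> parcs G" using i uv f_inj by metis
  qed
  moreover have "lg_label (lg_product I ?lam) l = map_option f (label_by p (\<Union>i\<in>I. S i) l)" for l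
  proof (cases "l \<in> p ` (\<Union>i\<in>I. S i)")
    case True
    then obtain i x where x: "i \<in> I" "x \<in> S i" "p x = l" by blast
    then have lx: "label_by p (S i) l = Some x" using injS by (simp add: label_by_Some_iff)
    with x(1) have dom: "\<exists>i\<in>I. l \<in> dom (label_by p (S i))" by blast
    have "(THE X. \<exists>i\<in>I. \<exists>x. label_by p (S i) l = Some x \<and> X = glue I ?lam (i, x)) = f x"
    proof (rule the_equality)
      show "\<exists>i\<in>I. \<exists>y. label_by p (S i) l = Some y \<and> f x = glue I ?lam (i, y)"
        using lx x(1,2) glue[of i x] SW[of i] by (intro bexI[of _ i] exI[of _ x]) auto
      fix X assume "\<exists>i\<in>I. \<exists>x. label_by p (S i) l = Some x \<and> X = glue I ?lam (i, x)"
      then obtain j y where y: "j \<in> I" "y \<in> S j" "p y = l" "X = glue I ?lam (j, y)"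
        using injS by (auto simp: label_by_Some_iff)
      then have "y = x" using x inj by (auto simp: inj_on_def)
      with y show "X = f x" using glue[of j y] SW[of j] by auto
    qed
    moreover have "label_by p (\<Union>i\<in>I. S i) l = Some x"
      using x inj by (auto simp: label_by_Some_iff)
    ultimately show ?thesis using dom by (simp add: lg_product_def)
  next
    case False
    then have "label_by p (\<Union>i\<in>I. S i) l = None" "\<And>i. i \<in> I \<Longrightarrow> label_by p (S i) l = None"
      by (auto simp: label_by_None_iff)
    then show ?thesis by (auto simp: lg_product_def)
  qed
  ultimately show ?thesis
    unfolding lgraph_iso_def by (intro exI[of _ f]) auto
qed

lemma lg_product_cong:
  assumes "\<And>i. i \<in> I \<Longrightarrow> H i = H' i"
  shows "lg_product I H = lg_product I H'"
proof -
  have "common_label I H = common_label I H'"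
    using assms by (auto simp: common_label_def)
  then have "glue I H = glue I H'" by (intro ext) (simp add: glue_def)
  then show ?thesis
    using assms by (simp add: lg_product_def cong: conj_cong bex_cong if_cong)
qed

lemma lgraph_iso_refl: "lgraph_iso H H"
  unfolding lgraph_iso_def by (intro exI[of _ id]) (auto simp: option.map_id)

section \<open>The construction tree of a pebbled forest\<close>

locale pebbled_parent_forest = parent_forest "pverts G" R par d
  for G :: "nat pair_pre_digraph" and R par d +
  fixes k q :: nat and p :: "nat \<Rightarrow> nat"
  assumes G: "pair_graph G" and zero: "0 \<notin> pverts G"
    and pebbled: "pebbled_order k q G le p"
begin

abbreviation "V \<equiv> pverts G"

text \<open>The ancestors of \<open>x\<close> whose pebble has not been reused up to \<open>x\<close>.\<close>

definition active :: "nat \<Rightarrow> nat set" where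
  "active x = {u. le u x \<and> (\<forall>w. le u w \<longrightarrow> u \<noteq> w \<longrightarrow> le w x \<longrightarrow> p w \<noteq> p u)}"

text \<open>At the virtual root 0, which is not a vertex, this is all of \<open>V\<close>, so that
  the root of the construction tree receives the whole of \<open>G\<close>.\<close>

definition below :: "nat \<Rightarrow> nat set" where
  "below x = (if x = 0 then V else {y. le x y})"

definition ppar :: "nat \<Rightarrow> nat" where
  "ppar x = (if x \<in> R then 0 else par x)"

text \<open>For \<open>x \<in> V\<close>, and for the virtual root \<open>x = 0\<close> above all roots of the forest, the construction tree
  has a product node \<open>6x\<close> with two (identical) leaves \<open>6x + 3\<close> and \<open>6x + 4\<close>, so that it always has more
  than one child; the elimination node of \<open>x \<in> V\<close> is \<open>6x + 5\<close>. The residues 1 and 2 are avoided because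
  the simplifier rewrites them with \<^const>\<open>Suc\<close>.\<close>

definition tpar :: "nat \<Rightarrow> nat" where
  "tpar n = (if n mod 6 = 0 then n + 5 else if n mod 6 = 5 then 6 * ppar (n div 6) else n - n mod 6)"

text \<open>A vertex \<open>x\<close> occupies the levels \<open>3 * d x + 2\<close> (elimination),
  \<open>3 * d x + 3\<close> (product) and \<open>3 * d x + 4\<close> (leaves). As \<open>d\<close>
  rises by at least one per forest step, the factor 3 puts the elimination node beyond the product
  node of its parent; the shift by 3 puts even a root with \<open>d x = 0\<close> beyond the virtual
  root at level 0.\<close>

definition td :: "nat \<Rightarrow> nat" where
  "td n = (let D = (if n div 6 = 0 then 0 else 3 * d (n div 6) + 3) in
     if n mod 6 = 0 then D else if n mod 6 = 5 then D - 1 else D + 1)"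

text \<open>The virtual root is not a vertex to be eliminated, hence the extra condition for residue
  5.\<close>

definition tV :: "nat set" where
  "tV = {n. n div 6 \<in> insert 0 V \<and> n mod 6 \<in> {0, 3, 4, 5} \<and>
    (n mod 6 = 5 \<longrightarrow> n div 6 \<in> V)}"

definition lam :: "nat \<Rightarrow> nat lgraph" where
  "lam n = (let x = n div 6 in
     if n mod 6 = 0 then labelled_subgraph G p (below x \<union> active x) (active x)
     else if n mod 6 = 5 then labelled_subgraph G p (below x \<union> active x) (active x - {x})
     else labelled_subgraph G p (active x) (active x))"

lemma ppar_in: "x \<in> V \<Longrightarrow> ppar x \<in> insert 0 V"
  using par_in by (auto simp: ppar_def)

lemma V_pos: "x \<in> V \<Longrightarrow> 0 < x"
  using zero by (cases x) auto

lemma le_ppar: "x \<in> V \<Longrightarrow> le u (ppar x) \<Longrightarrow> le u x"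
  using le_par[of x] le_trans[of u "par x" x] le_inD zero by (auto simp: ppar_def split: if_splits)

lemma le_ppar_iff: "x \<in> V \<Longrightarrow> le u x \<longleftrightarrow> u = x \<or> le u (ppar x)"
  using le_unfold[of u x] le_ppar[of x u] le_refl by (auto simp: ppar_def le_root)

lemma not_le_ppar: "x \<in> V \<Longrightarrow> \<not> le x (ppar x)"
  using not_le_par[of x] le_inD zero by (auto simp: ppar_def)

lemma tree_nodes_cases:
  assumes "n \<in> tV"
  obtains (product) x where "n = 6 * x" "x \<in> insert 0 V"
    | (leaf) x where "n = 6 * x + 3 \<or> n = 6 * x + 4" "x \<in> insert 0 V"
    | (elim) x where "n = 6 * x + 5" "x \<in> V"
proof -
  consider "n mod 6 = 0" | "n mod 6 = 3 \<or> n mod 6 = 4" | "n mod 6 = 5"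
    using assms by (auto simp: tV_def)
  then show ?thesis
  proof cases
    case 1
    then have "n = 6 * (n div 6)" by presburger
    then show ?thesis using that(1) assms unfolding tV_def by blast
  next
    case 2
    then have "n = 6 * (n div 6) + 3 \<or> n = 6 * (n div 6) + 4" by presburger
    then show ?thesis using that(2) assms unfolding tV_def by blast
  next
    case 3
    then have "n = 6 * (n div 6) + 5" by presburger
    then show ?thesis using that(3) assms 3 unfolding tV_def by blast
  qed
qed

lemma tpar_simps [simp]:
  "tpar (6 * x) = 6 * x + 5" "tpar (6 * x + 5) = 6 * ppar x"
  "tpar (6 * x + 3) = 6 * x" "tpar (6 * x + 4) = 6 * x" "tpar 3 = 0" "tpar 4 = 0"
  by (simp_all add: tpar_def)

lemma lam_simps [simp]:
  "lam (6 * x) = labelled_subgraph G p (below x \<union> active x) (active x)"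
  "lam (6 * x + 5) = labelled_subgraph G p (below x \<union> active x) (active x - {x})"
  "lam (6 * x + 3) = labelled_subgraph G p (active x) (active x)"
  "lam (6 * x + 4) = labelled_subgraph G p (active x) (active x)"
  "lam 3 = labelled_subgraph G p (active 0) (active 0)"
  "lam 4 = labelled_subgraph G p (active 0) (active 0)"
  by (simp_all add: lam_def)

lemma tV_simps [simp]:
  "6 * x \<in> tV \<longleftrightarrow> x \<in> insert 0 V" "6 * x + 5 \<in> tV \<longleftrightarrow> x \<in> V"
  "6 * x + 3 \<in> tV \<longleftrightarrow> x \<in> insert 0 V" "6 * x + 4 \<in> tV \<longleftrightarrow> x \<in> insert 0 V"
  "0 \<in> tV" "3 \<in> tV" "4 \<in> tV"
  by (auto simp add: tV_def)

lemma finite_tV: "finite tV"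
proof (rule finite_subset)
  show "tV \<subseteq> (\<Union>x\<in>insert 0 V. {6 * x, 6 * x + 3, 6 * x + 4, 6 * x + 5})"
  proof
    fix n assume "n \<in> tV"
    then show "n \<in> (\<Union>x\<in>insert 0 V. {6 * x, 6 * x + 3, 6 * x + 4, 6 * x + 5})"
      by (cases rule: tree_nodes_cases) auto
  qed
qed (use finite_V in auto)

sublocale T: parent_tree tV 0 tpar td
proof (unfold parent_tree_def, unfold_locales)
  show "finite tV" by (rule finite_tV)
  show "{0} \<subseteq> tV" by (simp add: tV_def)
  fix n assume n: "n \<in> tV - {0}"
  then have "n \<in> tV" by simp
  then show "tpar n \<in> tV"
    by (cases rule: tree_nodes_cases) (use n ppar_in in auto)
  from \<open>n \<in> tV\<close> show "td (tpar n) < td n"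
  proof (cases rule: tree_nodes_cases)
    case (product x)
    with n show ?thesis by (simp add: td_def)
  next
    case (leaf x)
    then show ?thesis by (auto simp: td_def)
  next
    case (elim x)
    then have "0 < x" by (simp add: V_pos)
    with elim show ?thesis using par_d[of x] by (auto simp: td_def ppar_def)
  qed
qed

abbreviation "ch \<equiv> children T.graph 0"

lemma ch_product: "x \<in> insert 0 V \<Longrightarrow>
  ch (6 * x) = {6 * x + 3, 6 * x + 4} \<union> (\<lambda>c. 6 * c + 5) ` {c \<in> V. ppar c = x}"
proof (intro set_eqI iffI)
  fix n assume "n \<in> ch (6 * x)"
  then have n: "n \<in> tV" "tpar n = 6 * x" "n \<noteq> 0" by (auto simp: T.children_graph)
  from n(1) show "n \<in> {6 * x + 3, 6 * x + 4} \<union> (\<lambda>c. 6 * c + 5) ` {c \<in> V. ppar c = x}"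
  proof (cases rule: tree_nodes_cases)
    case (product y)
    with n have "6 * y + 5 = 6 * x" by simp
    then have False by presburger
    then show ?thesis ..
  qed (use n in auto)
qed (auto simp: T.children_graph tV_simps)

lemma ch_leaf: "n = 6 * x + 3 \<or> n = 6 * x + 4 \<Longrightarrow> ch n = {}"
proof (intro set_eqI iffI)
  fix m assume n: "n = 6 * x + 3 \<or> n = 6 * x + 4" and "m \<in> ch n"
  then have m: "m \<in> tV" "tpar m = n" by (auto simp: T.children_graph)
  from m(1) show "m \<in> {}"
    by (cases rule: tree_nodes_cases) (use m n in \<open>auto; presburger\<close>)+
qed auto

lemma ch_elim: "x \<in> V \<Longrightarrow> ch (6 * x + 5) = {6 * x}"
proof (intro set_eqI iffI)
  fix m assume "x \<in> V" and "m \<in> ch (6 * x + 5)"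
  then have m: "m \<in> tV" "tpar m = 6 * x + 5" by (auto simp: T.children_graph)
  from m(1) show "m \<in> {6 * x}"
    by (cases rule: tree_nodes_cases) (use m in \<open>auto; presburger\<close>)+
qed (auto simp: T.children_graph V_pos)

section \<open>Pebbled ancestors and subtrees\<close>

lemma inj_active: "inj_on p (active x)"
proof (rule inj_onI)
  fix u v assume *: "u \<in> active x" "v \<in> active x" "p u = p v"
  \<comment> \<open>Of two comparable vertices with the same pebble, the lower one would have taken
    it from the upper one.\<close>
  then have "le u v \<or> le v u" using le_chain by (auto simp: active_def)
  with * show "u = v" by (auto simp: active_def)
qed

lemma active_sub: "active x \<subseteq> V"
  using le_inD by (auto simp: active_def)

lemma below_sub: "below x \<subseteq> V"
  using le_inD by (auto simp: below_def)

lemma below_V: "x \<in> V \<Longrightarrow> y \<in> below x \<longleftrightarrow> le x y"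
  using zero by (auto simp: below_def)

lemma self_below: "x \<in> V \<Longrightarrow> x \<in> below x"
  by (simp add: below_V le_refl)

lemma self_active: "x \<in> V \<Longrightarrow> x \<in> active x"
  using le_refl le_antisym by (auto simp: active_def)

lemma active_zero: "active 0 = {}"
  using le_inD zero by (auto simp: active_def)

text \<open>The stretch from \<open>u\<close> to \<open>ppar c\<close> is part of the stretch from
  \<open>u\<close> to \<open>c\<close>, so a pebble still held at \<open>c\<close> is also held at
  the parent.\<close>

lemma active_child: "c \<in> V \<Longrightarrow> active c - {c} \<subseteq> active (ppar c)"
  by (auto simp: active_def le_ppar_iff)

lemma below_child:
  assumes c: "c \<in> V"
  shows "below c \<subseteq> below (ppar c)"
proof (cases "ppar c = 0")
  case True
  then show ?thesis using below_sub by (simp add: below_def)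
next
  case False
  then have "ppar c \<in> V" using ppar_in[OF c] by simp
  moreover from this have "le (ppar c) c" using le_ppar[OF c] le_refl by blast
  ultimately show ?thesis using c le_trans[of "ppar c" c] by (auto simp: below_V)
qed

lemma below_split: "x \<in> insert 0 V \<Longrightarrow> y \<in> below x \<Longrightarrow> y \<noteq> x \<Longrightarrow> \<exists>c\<in>V. ppar c = x \<and> y \<in> below c"
proof -
  assume x: "x \<in> insert 0 V" "y \<in> below x" "y \<noteq> x"
  then have "y \<in> V" using below_sub by blast
  then show ?thesis using x
  proof (induction y rule: par_induct)
    case (root r)
    then have "x = 0" by (auto simp: below_def le_root split: if_splits)
    with root show ?case using R_sub zero le_refl by (intro bexI[of _ r]) (auto simp: ppar_def below_def)
  next
    case (step y)
    show ?case
    proof (cases "par y = x")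
      case True
      with step show ?thesis using self_below by (intro bexI[of _ y]) (auto simp: ppar_def)
    next
      case False
      then have "par y \<in> below x"
        using step.prems step.hyps par_in le_unfold[of x y] by (auto simp: below_def split: if_splits)
      with step False obtain c where c: "c \<in> V" "ppar c = x" "par y \<in> below c" by blast
      then have "le c y" using le_trans[OF _ le_par[OF step.hyps]] below_V by blast
      then show ?thesis using c below_V by blast
    qed
  qed
qed

lemma active_not_below: "c \<in> V \<Longrightarrow> y \<in> active (ppar c) \<Longrightarrow> y \<notin> below c"
  using not_le_ppar[of c] le_trans[of c y "ppar c"] zero by (auto simp: active_def below_def)

lemma siblings_disjoint:
  "c \<in> V \<Longrightarrow> c' \<in> V \<Longrightarrow> ppar c = ppar c' \<Longrightarrow> c \<noteq> c' \<Longrightarrow> y \<in> below c \<Longrightarrow> y \<notin> below c'"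
  using le_chain[of c y c'] le_ppar_iff[of c c'] le_ppar_iff[of c' c] not_le_ppar[of c]
    not_le_ppar[of c'] by (simp add: below_V) blast

text \<open>The children are the pieces of \<open>lgraph_iso_product\<close>: the pieces of
  different children meet only in labelled vertices, and every edge lies in one piece because an
  ancestor adjacent to the subtree of a child still holds its pebble at that child.\<close>

lemma lam_product:
  assumes x: "x \<in> insert 0 V"
  shows "lgraph_iso (lam (6 * x)) (lg_product (ch (6 * x)) lam)"
proof -
  define W where "W n = (if n mod 6 = 5 then below (n div 6) \<union> active (n div 6) else active (n div 6))" for n
  define S where "S n = (if n mod 6 = 5 then active (n div 6) - {n div 6} else active (n div 6))" for n
  let ?I = "ch (6 * x)"
  have W: "W (6 * c + 5) = below c \<union> active c" "W (6 * c + 3) = active c" "W (6 * c + 4) = active c"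
    and S: "S (6 * c + 5) = active c - {c}" "S (6 * c + 3) = active c" "S (6 * c + 4) = active c" for c
    by (simp_all add: W_def S_def)
  have I: "?I = {6 * x + 3, 6 * x + 4} \<union> (\<lambda>c. 6 * c + 5) ` {c \<in> V. ppar c = x}"
    by (rule ch_product[OF x])
  have lam: "lam i = labelled_subgraph G p (W i) (S i)" if "i \<in> ?I" for i
    using that unfolding I by (auto simp only: W S lam_simps)
  have US: "(\<Union>i\<in>?I. S i) = active x"
    unfolding I using active_child by (auto simp only: UN_Un UN_insert UN_empty image_Union S) blast
  have UW: "(\<Union>i\<in>?I. W i) = below x \<union> active x"
  proof
    show "(\<Union>i\<in>?I. W i) \<subseteq> below x \<union> active x"
      unfolding I
    proof (safe)
      fix c y assume *: "c \<in> V" "y \<in> W (6 * c + 5)" "x = ppar c" "y \<notin> active (ppar c)"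
      then consider "y \<in> below c" | "y \<in> active c - {c}" | "y = c" unfolding W by blast
      then show "y \<in> below (ppar c)"
      proof cases
        case 1
        then show ?thesis using below_child * by blast
      next
        case 2
        then show ?thesis using active_child * by blast
      next
        case 3
        then have "y \<in> below c" using * self_below by simp
        then show ?thesis using below_child * by blast
      qed
    qed (simp_all only: W)
    show "below x \<union> active x \<subseteq> (\<Union>i\<in>?I. W i)"
    proof
      fix y assume "y \<in> below x \<union> active x"
      then consider "y \<in> active x" | "y \<in> below x" "y \<notin> active x" by blast
      then show "y \<in> (\<Union>i\<in>?I. W i)"
      proof cases
        case 1
        then show ?thesis unfolding I using W(2)[of x] by blast
      next
        case 2
        then have "y \<noteq> x" using self_active[of x] below_sub x zero by blast
        then obtain c where "c \<in> V" "ppar c = x" "y \<in> below c" using below_split x 2 by blast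
        then show ?thesis unfolding I using W(1)[of c] by blast
      qed
    qed
  qed
  have "lgraph_iso (labelled_subgraph G p (\<Union>i\<in>?I. W i) (\<Union>i\<in>?I. S i))
    (lg_product ?I (\<lambda>i. labelled_subgraph G p (W i) (S i)))"
  proof (rule lgraph_iso_product)
    show "irrefl (parcs G)" using G by (simp add: pair_graph_iff)
    show "inj_on p (\<Union>i\<in>?I. S i)" unfolding US by (rule inj_active)
    show "S i \<subseteq> W i" if "i \<in> ?I" for i by (auto simp: S_def W_def)
    show "y \<in> S i" if ij: "i \<in> ?I" "j \<in> ?I" "i \<noteq> j" and y: "y \<in> W i" "y \<in> W j" for i j y
    proof -
      consider "S i = W i" | c where "c \<in> V" "ppar c = x" "i = 6 * c + 5"
        using ij(1) unfolding I by (auto simp only: W S)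
      then show ?thesis
      proof cases
        case (2 c)
        \<comment> \<open>Outside the subtree of \<open>c\<close> its piece consists of labelled
          vertices only, so it suffices that the other piece avoids this subtree.\<close>
        have "y \<notin> below c"
        proof -
          consider "W j = active x" | c' where "c' \<in> V" "ppar c' = x" "j = 6 * c' + 5"
            using ij(2) unfolding I by (auto simp only: W S)
          then show ?thesis
          proof cases
            case 1
            then show ?thesis using active_not_below 2 y by auto
          next
            case (2 c')
            note c' = this
            show ?thesis
            proof
              assume yc: "y \<in> below c"
              have cc: "c \<noteq> c'" using ij \<open>i = 6 * c + 5\<close> c' by auto
              then have "y \<notin> below c'" using siblings_disjoint c' \<open>c \<in> V\<close> \<open>ppar c = x\<close> yc by blast
              moreover from this have "y \<noteq> c'" using c' self_below by blast
              ultimately have "y \<in> active (ppar c')" using y c' active_child[of c'] unfolding c'(3) W by blast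
              then show False using active_not_below[of c y] \<open>c \<in> V\<close> \<open>ppar c = x\<close> c' yc by simp
            qed
          qed
        qed
        moreover from this have "y \<noteq> c" using 2 self_below by blast
        ultimately show ?thesis using y 2 W S by auto
      qed (use y in simp)
    qed
    fix u v assume uv: "(u, v) \<in> parcs G" "u \<in> (\<Union>i\<in>?I. W i)" "v \<in> (\<Union>i\<in>?I. W i)"
    \<comment> \<open>An end \<open>v\<close> that is not active at \<open>x\<close> lies in the
      subtree of a child \<open>c\<close>. The other end is in that subtree too, or it is an
      ancestor of \<open>c\<close>; in the latter case the pebble condition for the edge covers all
      vertices down to \<open>c\<close>, so \<open>u\<close> is active at \<open>c\<close>.\<close>
    have key: "\<exists>i\<in>?I. u \<in> W i \<and> v \<in> W i"
      if uv: "(u, v) \<in> parcs G" "u \<in> below x \<union> active x" "v \<in> below x" "v \<notin> active x" for u v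
    proof -
      have "v \<noteq> x" using self_active[of x] below_sub x zero uv by blast
      then obtain c where c: "c \<in> V" "ppar c = x" "v \<in> below c" using below_split x uv by blast
      have cv: "le c v" using c(1,3) by (simp add: below_V)
      have "u \<in> below c \<union> active c"
      proof (cases "le c u")
        case True
        then show ?thesis using c(1) by (simp add: below_V)
      next
        case False
        have "le u v \<or> le v u" using pebbled uv by (auto simp: pebbled_order_def)
        then have "le u v" using False cv le_trans by blast
        then have "le u c" using False cv le_chain by blast
        moreover have "p w \<noteq> p u" if "le u w" "u \<noteq> w" "le w c" for w
          using pebbled uv(1) that le_trans[OF that(3) cv] unfolding pebbled_order_def by blast
        ultimately show ?thesis by (auto simp: active_def)
      qed
      then show ?thesis using c W(1)[of c] unfolding I by blast
    qed
    have sym: "(v, u) \<in> parcs G" using uv(1) G by (auto simp: pair_graph_iff sym_def)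
    show "\<exists>i\<in>?I. u \<in> W i \<and> v \<in> W i"
    proof (cases "u \<in> active x \<and> v \<in> active x")
      case True
      then show ?thesis using W(2)[of x] unfolding I by blast
    next
      case False
      then show ?thesis using key[OF uv(1)] key[OF sym] uv(2,3) unfolding UW by blast
    qed
  qed
  moreover have "lg_product ?I lam = lg_product ?I (\<lambda>i. labelled_subgraph G p (W i) (S i))"
    using lam by (rule lg_product_cong)
  ultimately show ?thesis unfolding US UW by simp
qed

text \<open>This turns the elimination nodes on a branch into forest predecessors of a single
  vertex, whose number is bounded by \<open>q\<close>.\<close>

lemma T_le_elim: "T.le (6 * u + 5) n \<Longrightarrow> le u (n div 6)"
proof -
  assume le: "T.le (6 * u + 5) n"
  then have "n \<in> tV" using T.le_inD by blast
  then show ?thesis using le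
  proof (induction n rule: T.par_induct)
    case (root r)
    then show ?case using T.le_root by auto
  next
    case (step n)
    then have n: "n \<in> tV" by simp
    show ?case
    proof (cases "6 * u + 5 = n")
      case True
      with n have "u \<in> V" by auto
      then show ?thesis using True le_refl by auto
    next
      case False
      then have "le u (tpar n div 6)" using step T.le_unfold[of _ n] by blast
      with n show ?thesis
        by (cases rule: tree_nodes_cases) (auto intro: le_ppar)
    qed
  qed
qed

lemma construction_tree_T: "construction_tree k (unlabelled G) T.graph 0 lam"
  unfolding construction_tree_def
proof (intro conjI ballI allI impI)
  show "rooted_tree T.graph 0" by (rule T.rooted_tree_graph)
next
  fix n assume "n \<in> pverts T.graph"
  have lab: "k_labelled k (labelled_subgraph G p W S)" if "W \<subseteq> V" "S \<subseteq> W" "inj_on p S" for W S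
  proof -
    have "finite W" using that finite_V finite_subset by blast
    then have "pair_graph \<lparr>pverts = W, parcs = parcs G \<inter> W \<times> W\<rparr>"
      using G by (auto simp: pair_graph_iff sym_def irrefl_def)
    moreover have "p ` V \<subseteq> {1..k}" using pebbled by (simp add: pebbled_order_def)
    ultimately show ?thesis
      using that by (auto simp: k_labelled_def labelled_subgraph_def label_by_Some_iff ran_def dom_def)
  qed
  from \<open>n \<in> pverts T.graph\<close> have "n \<in> tV" by simp
  then show "k_labelled k (lam n)"
  proof (cases rule: tree_nodes_cases)
    case (product x)
    show ?thesis unfolding product lam_simps
      by (rule lab) (use active_sub below_sub inj_active in auto)
  next
    case (leaf x)
    have "k_labelled k (labelled_subgraph G p (active x) (active x))"
      by (rule lab) (use active_sub inj_active in auto)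
    with leaf show ?thesis by auto
  next
    case (elim x)
    show ?thesis unfolding elim lam_simps
      by (rule lab) (use active_sub below_sub inj_active in \<open>auto intro: inj_on_diff\<close>)
  qed
next
  \<comment> \<open>Nothing is active at the virtual root, so its graph is \<open>G\<close> without
    labels.\<close>
  have "parcs G \<inter> V \<times> V = parcs G" using G by (auto simp: pair_graph_iff)
  then have "lam 0 = unlabelled G"
    using lam_simps(1)[of 0] active_zero
    by (auto simp: labelled_subgraph_def unlabelled_def below_def label_by_def)
  then show "lgraph_iso (lam 0) (unlabelled G)" by (simp add: lgraph_iso_refl)
next
  fix n assume "n \<in> leaves T.graph 0"
  then have n: "n \<in> tV" "ch n = {}" by (auto simp: leaves_def)
  from n(1) show "fully_labelled (lam n)"
  proof (cases rule: tree_nodes_cases)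
    case (leaf x)
    have "active x \<subseteq> ran (label_by p (active x))"
      using label_by_Some_iff[OF inj_active] by (auto simp: ran_def)
    with leaf show ?thesis by (auto simp: fully_labelled_def)
  qed (use n ch_product ch_elim in auto)
next
  fix n s assume n: "n \<in> pverts T.graph" "ch n = {s}"
  then have "n \<in> tV" by simp
  then show "\<exists>l\<in>dom (lg_label (lam s)). lam n = remove_label l (lam s)"
  proof (cases rule: tree_nodes_cases)
    case (product x)
    with n ch_product have "6 * x + 3 = s" "6 * x + 4 = s" by auto
    then have False by linarith
    then show ?thesis ..
  next
    case (leaf x)
    then show ?thesis using n ch_leaf by auto
  next
    case (elim x)
    with n ch_elim have s: "s = 6 * x" by simp
    have x: "label_by p (active x) (p x) = Some x"
      using self_active[OF elim(2)] by (simp add: label_by_Some_iff inj_active)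
    have "label_by p (active x - {x}) = (label_by p (active x))(p x := None)"
      using self_active[OF elim(2)] by (intro label_by_remove inj_active)
    then have "lam n = remove_label (p x) (lam s)"
      unfolding s elim(1) lam_simps by (auto simp: remove_label_def labelled_subgraph_def)
    then show ?thesis using x by (intro bexI[of _ "p x"]) (auto simp: s)
  qed
next
  fix n assume n: "n \<in> pverts T.graph" "card (ch n) > 1"
  then have "n \<in> tV" by simp
  then show "lgraph_iso (lam n) (lg_product (ch n) lam)"
    by (cases rule: tree_nodes_cases) (use n ch_leaf ch_elim lam_product in auto)
qed

lemma elimination_depth_T: "elimination_depth T.graph 0 \<le> q"
proof -
  have fin: "finite (leaves T.graph 0)" using finite_tV by (auto simp: leaves_def)
  have leaf0: "3 \<in> leaves T.graph 0" using tV_simps(3)[of 0] ch_leaf[of 3 0] by (auto simp: leaves_def)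
  have "card {t \<in> elimination_nodes T.graph 0. on_path T.graph 0 t v} \<le> q"
    if v: "v \<in> leaves T.graph 0" for v
  proof -
    interpret O: forest_order V le by (rule forest_order_le)
    have "{t \<in> elimination_nodes T.graph 0. on_path T.graph 0 t v} \<subseteq>
      (\<lambda>u. 6 * u + 5) ` {u. le u (v div 6)}"
    proof
      fix t assume "t \<in> {t \<in> elimination_nodes T.graph 0. on_path T.graph 0 t v}"
      then have t: "t \<in> tV" "card (ch t) = 1" "T.le t v"
        by (auto simp: elimination_nodes_def T.on_path_tree)
      from t(1) show "t \<in> (\<lambda>u. 6 * u + 5) ` {u. le u (v div 6)}"
      proof (cases rule: tree_nodes_cases)
        case (product x)
        \<comment> \<open>The twin leaves give a product node at least two children, so it cannot
          count as an elimination node.\<close>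
        have "card {6 * x + 3, 6 * x + 4} \<le> card (ch t)"
          using product ch_product finite_V by (intro card_mono) auto
        with t show ?thesis by simp
      next
        case (leaf x)
        then show ?thesis using t ch_leaf by auto
      next
        case (elim x)
        then show ?thesis using T_le_elim t(3) by blast
      qed
    qed
    then have "card {t \<in> elimination_nodes T.graph 0. on_path T.graph 0 t v} \<le>
        card ((\<lambda>u. 6 * u + 5) ` {u. le u (v div 6)})"
      using O.finite_below by (intro card_mono) auto
    also have "\<dots> \<le> card {u. le u (v div 6)}" using O.finite_below by (intro card_image_le)
    also have "\<dots> \<le> q"
    proof (cases "v div 6 \<in> V")
      case True
      then show ?thesis using pebbled by (simp add: pebbled_order_def)
    next
      case False
      \<comment> \<open>This is the case of the leaves at the virtual root, above which nothing is
        eliminated.\<close>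
      then have "{u. le u (v div 6)} = {}" using le_inD by blast
      then show ?thesis by simp
    qed
    finally show ?thesis .
  qed
  then show ?thesis
    unfolding elimination_depth_def using fin leaf0 by (subst Max_le_iff) auto
qed

end

section \<open>From construction trees to tree decompositions\<close>

lemma (in parent_forest) le_child:
  assumes "le t b" "t \<noteq> b"
  shows "\<exists>s\<in>V - R. par s = t \<and> le s b"
proof -
  have "b \<in> V" using assms le_inD by blast
  then show ?thesis using assms
  proof (induction b rule: par_induct)
    case (root b)
    then show ?case using le_rootD by blast
  next
    case (step b)
    then have "le t (par b)" using le_unfold[of t b] by blast
    show ?case
    proof (cases "t = par b")
      case True
      then show ?thesis using step.hyps le_refl by blast
    next
      case False
      with step \<open>le t (par b)\<close> obtain s where "s \<in> V - R" "par s = t" "le s (par b)" by blast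
      then show ?thesis using le_trans le_par[OF step.hyps] by blast
    qed
  qed
qed

lemma (in parent_forest) ex_max_depth:
  assumes "Z \<subseteq> V" "Z \<noteq> {}"
  shows "\<exists>n\<in>Z. \<forall>s\<in>Z. d s \<le> d n"
proof -
  have fin: "finite (d ` Z)" using assms finite_V finite_subset by auto
  then have "Max (d ` Z) \<in> d ` Z" using assms by (intro Max_in) auto
  then obtain n where "n \<in> Z" "d n = Max (d ` Z)" by (metis imageE)
  with fin show ?thesis by (intro bexI[of _ n]) auto
qed

lemma (in parent_forest) ex_min_depth:
  assumes "Z \<subseteq> V" "Z \<noteq> {}"
  shows "\<exists>n\<in>Z. \<forall>s\<in>Z. d n \<le> d s"
proof -
  have fin: "finite (d ` Z)" using assms finite_V finite_subset by auto
  then have "Min (d ` Z) \<in> d ` Z" using assms by (intro Min_in) auto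
  then obtain n where "n \<in> Z" "d n = Min (d ` Z)" by (metis imageE)
  with fin show ?thesis by (intro bexI[of _ n]) auto
qed

text \<open>\<open>m n\<close> maps the vertices \<open>X n\<close> at the node \<open>n\<close> to those at its parent, and \<open>g n\<close> is the resulting map
  into \<open>G\<close>; \<open>L n\<close> are the labelled vertices.\<close>

locale vertex_maps = parent_tree N r par d for N :: "'n set" and r par d +
  fixes G :: "'a pair_pre_digraph" and X :: "'n \<Rightarrow> 'b set" and E :: "'n \<Rightarrow> 'b rel"
    and L :: "'n \<Rightarrow> 'b set" and m :: "'n \<Rightarrow> 'b \<Rightarrow> 'b" and g :: "'n \<Rightarrow> 'b \<Rightarrow> 'a"
    and Elim :: "'n set"
  assumes root_bij: "bij_betw (g r) (X r) (pverts G)"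
    and root_edges: "(u, v) \<in> parcs G \<Longrightarrow> \<exists>x y. (x, y) \<in> E r \<and> g r x = u \<and> g r y = v"
    and root_L: "L r = {}"
    and E_sub: "n \<in> N \<Longrightarrow> E n \<subseteq> X n \<times> X n"
    and L_sub: "n \<in> N \<Longrightarrow> L n \<subseteq> X n"
    and finite_L: "n \<in> N \<Longrightarrow> finite (L n)"
    and g_step: "n \<in> N - {r} \<Longrightarrow> g n x = g (par n) (m n x)"
    and m_in: "n \<in> N - {r} \<Longrightarrow> x \<in> X n \<Longrightarrow> m n x \<in> X (par n)"
    and leaf: "n \<in> N \<Longrightarrow> children graph r n = {} \<Longrightarrow> X n = L n"
    and m_cover: "n \<in> N \<Longrightarrow> children graph r n \<noteq> {} \<Longrightarrow> y \<in> X n \<Longrightarrow>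
      \<exists>s\<in>children graph r n. \<exists>x\<in>X s. m s x = y"
    and m_edges: "n \<in> N \<Longrightarrow> children graph r n \<noteq> {} \<Longrightarrow> (y, y') \<in> E n \<Longrightarrow>
      \<exists>s\<in>children graph r n. \<exists>x x'. (x, x') \<in> E s \<and> m s x = y \<and> m s x' = y'"
    and m_unique: "n \<in> N \<Longrightarrow> y \<in> X n - L n \<Longrightarrow> s \<in> children graph r n \<Longrightarrow>
      s' \<in> children graph r n \<Longrightarrow> x \<in> X s \<Longrightarrow> x' \<in> X s' \<Longrightarrow> m s x = y \<Longrightarrow> m s' x' = y \<Longrightarrow>
      s = s' \<and> x = x'"
    and m_label: "n \<in> N - {r} \<Longrightarrow> x \<in> X n \<Longrightarrow> m n x \<in> L (par n) \<Longrightarrow> x \<in> L n"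
    and m_elim: "n \<in> N - {r} \<Longrightarrow> par n \<in> Elim \<Longrightarrow> \<exists>z. m n ` L n \<subseteq> insert z (L (par n))"
    and m_product: "n \<in> N - {r} \<Longrightarrow> par n \<notin> Elim \<Longrightarrow> m n ` L n \<subseteq> L (par n)"
begin

section \<open>Nodes and bags of a vertex of \<open>G\<close>\<close>

definition bag :: "'n \<Rightarrow> 'a set" where
  "bag n = g n ` L n"

text \<open>\<open>W v\<close> contains \<open>B v\<close> and is closed under parents; the
  connectedness of \<open>B v\<close> is proved inside it.\<close>

definition W :: "'a \<Rightarrow> 'n set" where
  "W v = {n \<in> N. v \<in> g n ` X n}"

definition B :: "'a \<Rightarrow> 'n set" where
  "B v = {n \<in> N. v \<in> bag n}"

lemma B_sub_W: "B v \<subseteq> W v"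
  using L_sub by (auto simp: B_def W_def bag_def)

lemma W_N: "n \<in> W v \<Longrightarrow> n \<in> N"
  by (simp add: W_def)

lemma W_par: "n \<in> W v \<Longrightarrow> n \<noteq> r \<Longrightarrow> par n \<in> W v"
  using g_step m_in par_in by (auto simp: W_def)

lemma W_le: "n \<in> W v \<Longrightarrow> le t n \<Longrightarrow> t \<in> W v"
proof -
  assume "n \<in> W v" "le t n"
  from W_N[OF this(1)] this show ?thesis
  proof (induction n rule: par_induct)
    case (root n)
    then show ?case using le_rootD by blast
  next
    case (step n)
    then show ?case using le_unfold[of t n] W_par[of n v] by auto
  qed
qed

lemma root_W: "v \<in> pverts G \<Longrightarrow> r \<in> W v"
  using root_bij r_in by (auto simp: W_def bij_betw_def)

text \<open>Once a vertex has a labelled preimage, all its preimages are labelled from there downwards.\<close>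

lemma fibre:
  assumes "n \<in> W v"
  shows "(\<exists>x\<in>X n - L n. \<forall>y\<in>X n. g n y = v \<longrightarrow> y = x) \<or> (\<forall>y\<in>X n. g n y = v \<longrightarrow> y \<in> L n)"
  using W_N[OF assms] assms
proof (induction n rule: par_induct)
  case (root n)
  then obtain x where "x \<in> X r" "g r x = v" by (auto simp: W_def)
  moreover from this have "\<forall>y\<in>X r. g r y = v \<longrightarrow> y = x"
    using root_bij by (auto simp: bij_betw_def inj_on_def)
  ultimately show ?case using root root_L by auto
next
  case (step n)
  have down: "m n y \<in> X (par n) \<and> g (par n) (m n y) = v" if "y \<in> X n" "g n y = v" for y
    using m_in[OF step.hyps] g_step[OF step.hyps] that by metis
  obtain y where y: "y \<in> X n" "g n y = v" using step.prems by (auto simp: W_def)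
  have n: "n \<in> children graph r (par n)" "par n \<in> N" using step.hyps par_in by (auto simp: children_graph)
  have "par n \<in> W v" using W_par step by blast
  then consider x where "x \<in> X (par n) - L (par n)" "\<forall>y\<in>X (par n). g (par n) y = v \<longrightarrow> y = x"
    | "\<forall>y\<in>X (par n). g (par n) y = v \<longrightarrow> y \<in> L (par n)"
    using step.IH by blast
  then show ?case
  proof cases
    case (1 x)
    have "z = y" if z: "z \<in> X n" "g n z = v" for z
    proof -
      have "m n z = x" "m n y = x" using down[OF z] down[OF y] 1(2) by blast+
      then show ?thesis using m_unique[OF n(2) 1(1) n(1) n(1) z(1) y(1)] by simp
    qed
    then show ?thesis using y(1) by (cases "y \<in> L n") blast+
  next
    case 2
    then have "\<forall>y\<in>X n. g n y = v \<longrightarrow> y \<in> L n" using down m_label[OF step.hyps] by blast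
    then show ?thesis ..
  qed
qed

lemma fibre_B: "n \<in> B v \<Longrightarrow> \<forall>y\<in>X n. g n y = v \<longrightarrow> y \<in> L n"
proof -
  assume n: "n \<in> B v"
  then obtain x where x: "x \<in> L n" "g n x = v" by (auto simp: B_def bag_def)
  then have xX: "x \<in> X n" using n L_sub by (auto simp: B_def)
  have "n \<in> W v" using n B_sub_W by blast
  from fibre[OF this] show ?thesis
  proof
    assume "\<exists>x\<in>X n - L n. \<forall>y\<in>X n. g n y = v \<longrightarrow> y = x"
    with x xX show ?thesis by blast
  qed
qed

text \<open>By \<open>fibre_B\<close> all preimages at the parent are labelled, and
  \<open>m_label\<close> passes this on to the child.\<close>

lemma B_down: "n \<in> W v \<Longrightarrow> n \<noteq> r \<Longrightarrow> par n \<in> B v \<Longrightarrow> n \<in> B v"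
proof -
  assume n: "n \<in> W v" "n \<noteq> r" "par n \<in> B v"
  then obtain y where y: "y \<in> X n" "g n y = v" and nN: "n \<in> N - {r}" by (auto simp: W_def)
  then have "m n y \<in> X (par n)" "g (par n) (m n y) = v" using m_in[OF nN] g_step[OF nN] by auto
  then have "m n y \<in> L (par n)" using fibre_B[OF n(3)] by blast
  then have "y \<in> L n" using m_label nN y by blast
  then show ?thesis using y nN by (auto simp: B_def bag_def)
qed

lemma B_le: "n \<in> W v \<Longrightarrow> le b n \<Longrightarrow> b \<in> B v \<Longrightarrow> n \<in> B v"
proof -
  assume "n \<in> W v" "le b n" "b \<in> B v"
  from W_N[OF this(1)] this show ?thesis
  proof (induction n rule: par_induct)
    case (root n)
    then show ?case using le_rootD by blast
  next
    case (step n)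
    then show ?case using le_unfold[of b n] W_par[of n v] B_down[of n v] by auto
  qed
qed

text \<open>Where \<open>v\<close> is not in the bag, its preimage is a single unlabelled vertex,
  and by \<open>m_unique\<close> such a vertex comes from only one child.\<close>

lemma child_unique:
  assumes "n \<in> W v - B v" "s \<in> N - {r}" "s' \<in> N - {r}" "par s = n" "par s' = n" "s \<in> W v" "s' \<in> W v"
  shows "s = s'"
proof -
  obtain x y where x: "x \<in> X s" "g s x = v" and y: "y \<in> X s'" "g s' y = v"
    using assms by (auto simp: W_def)
  have "m s x \<in> X n" "g n (m s x) = v" "m s' y \<in> X n" "g n (m s' y) = v"
    using x y m_in[OF assms(2)] m_in[OF assms(3)] g_step[OF assms(2)] g_step[OF assms(3)] assms(4,5)
    by auto
  note im = this
  have nN: "n \<in> N" and nW: "n \<in> W v" using assms(1) W_N by blast+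
  have nL: "m s x \<notin> L n" using assms(1) im(2) nN by (auto simp: B_def bag_def)
  have "m s' y = m s x"
    using fibre[OF nW]
  proof
    assume "\<exists>x\<in>X n - L n. \<forall>y\<in>X n. g n y = v \<longrightarrow> y = x"
    with im show ?thesis by blast
  next
    assume "\<forall>y\<in>X n. g n y = v \<longrightarrow> y \<in> L n"
    with im nL show ?thesis by blast
  qed
  moreover have "s \<in> children graph r n" "s' \<in> children graph r n"
    using assms by (auto simp: children_graph)
  moreover have "m s x \<in> X n - L n" using im nL by blast
  ultimately show ?thesis using m_unique[OF nN, of "m s x" s s' x y] x y by blast
qed

text \<open>Since an unlabelled vertex is never split among children, \<open>W v\<close> is a single
  branch down to the place where \<open>v\<close> becomes labelled.\<close>

lemma comparable:
  assumes "n \<in> W v - B v" "b \<in> W v"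
  shows "le n b \<or> le b n"
proof -
  have "n \<in> N" using assms W_N by blast
  then show ?thesis using assms
  proof (induction n rule: par_induct)
    case (root n)
    then show ?case using root_le W_N by blast
  next
    case (step n)
    then have t: "par n \<in> W v - B v" using W_par B_down by blast
    then consider "le b (par n)" | "le (par n) b" "par n \<noteq> b" using step by blast
    then show ?case
    proof cases
      case 1
      then show ?thesis using le_trans le_par[OF step.hyps] by blast
    next
      case 2
      then obtain s where s: "s \<in> N - {r}" "par s = par n" "le s b" using le_child by blast
      then have "s = n" using child_unique[OF t s(1) step.hyps s(2)] W_le step.prems by blast
      with s show ?thesis by blast
    qed
  qed
qed

text \<open>A deepest node with a preimage of \<open>v\<close> must be a leaf, because preimages
  lift to children; at a leaf all vertices are labelled.\<close>

lemma B_nonempty: "v \<in> pverts G \<Longrightarrow> B v \<noteq> {}"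
proof -
  assume "v \<in> pverts G"
  then have "W v \<noteq> {}" using root_W by blast
  then obtain n where n: "n \<in> W v" "\<And>s. s \<in> W v \<Longrightarrow> d s \<le> d n"
    using ex_max_depth[of "W v"] W_N by blast
  then obtain y where y: "y \<in> X n" "g n y = v" and nN: "n \<in> N" by (auto simp: W_def)
  have "children graph r n = {}"
  proof (rule ccontr)
    assume "children graph r n \<noteq> {}"
    then obtain s x where s: "s \<in> children graph r n" "x \<in> X s" "m s x = y"
      using m_cover nN y by blast
    then have sN: "s \<in> N - {r}" "par s = n" by (auto simp: children_graph)
    then have "g s x = v" using s y g_step[OF sN(1), of x] by simp
    then have "s \<in> W v" using s(2) sN(1) unfolding W_def by blast
    then show False using n(2) par_d sN by fastforce
  qed
  then show ?thesis using leaf nN y by (auto simp: B_def bag_def)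
qed

text \<open>Let \<open>b0\<close> be a topmost node of \<open>B v\<close>. If some other
  \<open>b\<close> in \<open>B v\<close> had its parent outside \<open>B v\<close>, then
  \<open>b0\<close> would lie below that parent, hence under the only child that contains
  \<open>v\<close>, which is \<open>b\<close>; this contradicts the choice of
  \<open>b0\<close>.\<close>

lemma connected_B:
  assumes "v \<in> pverts G"
  shows "connected (with_proj graph \<restriction> B v)"
proof -
  have BN: "B v \<subseteq> N" by (auto simp: B_def)
  obtain b0 where b0: "b0 \<in> B v" and min: "\<And>s. s \<in> B v \<Longrightarrow> d b0 \<le> d s"
    using ex_min_depth[OF BN B_nonempty[OF assms]] by blast
  show ?thesis
  proof (rule connectedI[OF b0 BN])
    fix b assume b: "b \<in> B v" "b \<noteq> b0"
    have br: "b \<noteq> r" using b root_L by (auto simp: B_def bag_def)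
    with b BN have bN: "b \<in> N - {r}" by blast
    have "par b \<in> B v"
    proof (rule ccontr)
      assume nB: "par b \<notin> B v"
      then have t: "par b \<in> W v - B v" using W_par B_sub_W b br by blast
      have b0W: "b0 \<in> W v" using b0 B_sub_W by blast
      have "\<not> le b0 (par b)" using B_le t b0 by blast
      then have "le (par b) b0" using comparable[OF t b0W] by blast
      then obtain s where s: "s \<in> N - {r}" "par s = par b" "le s b0"
        using le_child nB b0 by blast
      have "s = b" using child_unique[OF t s(1) bN s(2)] W_le[OF b0W s(3)] b B_sub_W by blast
      then have "d b < d b0" using le_d s(3) b(2) by blast
      with min[OF b(1)] show False by simp
    qed
    with br show "b \<noteq> r \<and> par b \<in> B v" by blast
  qed
qed

text \<open>An edge is lifted to ever deeper nodes until a leaf is reached, where both ends are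
  labelled.\<close>

lemma bag_edge: "(u, v) \<in> parcs G \<Longrightarrow> \<exists>n\<in>N. u \<in> bag n \<and> v \<in> bag n"
proof -
  assume uv: "(u, v) \<in> parcs G"
  let ?Z = "{n \<in> N. \<exists>x y. (x, y) \<in> E n \<and> g n x = u \<and> g n y = v}"
  have "r \<in> ?Z" using root_edges[OF uv] r_in by blast
  then obtain n where "n \<in> ?Z" and max: "\<And>s. s \<in> ?Z \<Longrightarrow> d s \<le> d n"
    using ex_max_depth[of ?Z] by blast
  then obtain x y where n: "n \<in> N" "(x, y) \<in> E n" "g n x = u" "g n y = v" by blast
  have "children graph r n = {}"
  proof (rule ccontr)
    assume "children graph r n \<noteq> {}"
    then obtain s x' y' where s: "s \<in> children graph r n" "(x', y') \<in> E s" "m s x' = x" "m s y' = y"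
      using m_edges n by blast
    then have sN: "s \<in> N - {r}" "par s = n" by (auto simp: children_graph)
    then have "g s x' = u" "g s y' = v" using s n g_step[OF sN(1)] by auto
    then have "s \<in> ?Z" using s sN by blast
    then show False using max par_d sN by fastforce
  qed
  then have "X n = L n" using leaf n by blast
  then have "x \<in> L n" "y \<in> L n" using n(2) E_sub[OF n(1)] by auto
  then show ?thesis using n unfolding bag_def by blast
qed

lemma g_in: "n \<in> N \<Longrightarrow> x \<in> X n \<Longrightarrow> g n x \<in> pverts G"
proof (induction n arbitrary: x rule: par_induct)
  case (root n)
  then show ?case using root_bij by (auto simp: bij_betw_def)
next
  case (step n)
  then show ?case using g_step[OF step.hyps] m_in[OF step.hyps] by simp
qed

lemma bag_sub: "n \<in> N \<Longrightarrow> bag n \<subseteq> pverts G"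
  using g_in L_sub by (auto simp: bag_def)

lemma tree_decomposition_bag: "tree_decomposition G graph bag"
proof -
  have "ugraph_tree graph" using rooted_tree_graph by (simp add: rooted_tree_def)
  moreover have "{t \<in> pverts graph. v \<in> bag t} = B v" for v by (simp add: B_def)
  ultimately show ?thesis
    unfolding tree_decomposition_def
    using bag_sub bag_edge connected_B B_nonempty by (fastforce simp: B_def)
qed

text \<open>The bag at the root is empty, and a node adds at most one vertex to the bag of its
  parent, and only if the parent eliminates. So a node is charged to its parent, and only
  elimination nodes strictly above \<open>n\<close> count.\<close>

lemma path_bags:
  assumes "n \<in> N"
  shows "card (\<Union>t\<in>{t. le t n}. bag t) \<le> card {t \<in> Elim. le t n \<and> t \<noteq> n}"
  using assms
proof (induction n rule: par_induct)
  case (root n)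
  then have "(\<Union>t\<in>{t. le t n}. bag t) = {}" using le_rootD root_L by (auto simp: bag_def)
  then show ?case by (simp only: card.empty)
next
  case (step n)
  let ?U = "\<lambda>n. \<Union>t\<in>{t. le t n}. bag t" and ?t = "par n"
  have nN: "n \<in> N" and tN: "?t \<in> N" using step.hyps par_in by auto
  have le_n: "le s n \<longleftrightarrow> s = n \<or> le s ?t" for s using le_unfold[of s n] step.hyps by blast
  have "{t. le t n} = insert n {t. le t ?t}" by (auto simp: le_n)
  then have U: "?U n = ?U ?t \<union> bag n" by (simp add: Un_commute)
  have fin_le: "finite {t. le t s}" for s by (rule finite_subset[OF _ finite_V]) (use le_inD in blast)
  have finU: "finite (?U s)" for s
    using fin_le[of s] finite_L le_inD by (auto simp: bag_def)
  have bag_t: "bag ?t \<subseteq> ?U ?t" using le_refl[OF tN] by blast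
  have bag_n: "bag n = g ?t ` (m n ` L n)"
    using g_step[OF step.hyps] by (auto simp: bag_def image_iff)
  \<comment> \<open>Passing from the parent to \<open>n\<close> raises the count exactly when the
    parent is an elimination node.\<close>
  have below: "{t \<in> Elim. le t n \<and> t \<noteq> n} = {t \<in> Elim. le t ?t}"
    using not_le_par[OF step.hyps] by (auto simp: le_n)
  show ?case
  proof (cases "?t \<in> Elim")
    case True
    then obtain z where "m n ` L n \<subseteq> insert z (L ?t)" using m_elim step.hyps by blast
    then have "bag n \<subseteq> insert (g ?t z) (bag ?t)" unfolding bag_n by (auto simp: bag_def)
    then have "?U n \<subseteq> insert (g ?t z) (?U ?t)" unfolding U using bag_t by blast
    then have "card (?U n) \<le> card (insert (g ?t z) (?U ?t))"
      using finU[of ?t] by (intro card_mono) blast+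
    also have "\<dots> \<le> Suc (card (?U ?t))" by (rule card_insert_le_m1) simp_all
    also have "\<dots> \<le> Suc (card {t \<in> Elim. le t ?t \<and> t \<noteq> ?t})" using step.IH by simp
    also have "\<dots> = card (insert ?t {t \<in> Elim. le t ?t \<and> t \<noteq> ?t})"
      using fin_le[of ?t] by (subst card_insert_disjoint) (auto intro: finite_subset)
    also have "insert ?t {t \<in> Elim. le t ?t \<and> t \<noteq> ?t} = {t \<in> Elim. le t ?t}"
      using True le_refl[OF tN] by auto
    finally show ?thesis unfolding below .
  next
    case False
    then have "bag n \<subseteq> bag ?t"
      unfolding bag_n using m_product[OF step.hyps False] by (auto simp: bag_def)
    then have "?U n = ?U ?t" unfolding U using bag_t by blast
    moreover have "{t \<in> Elim. le t ?t} = {t \<in> Elim. le t ?t \<and> t \<noteq> ?t}" using False by auto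
    ultimately show ?thesis unfolding below using step.IH by simp
  qed
qed

end

subsection \<open>Projections of products\<close>

lemma sym_common_label: "sym (common_label I H)"
  by (auto simp: sym_def common_label_def)

lemma glue_eq: "((i, x), (j, y)) \<in> common_label I H \<Longrightarrow> glue I H (i, x) = glue I H (j, y)"
  using sym_rtrancl[OF sym_common_label, of I H]
  by (auto simp: glue_def sym_def intro: converse_rtrancl_into_rtrancl)
    (meson r_into_rtrancl rtrancl_trans)

text \<open>The first and the last step of a chain that glues two different vertices both come from
  a common label.\<close>

lemma glue_labelled:
  assumes "glue I H (i, x) = glue I H (j, y)" "(i, x) \<noteq> (j, y)"
  shows "x \<in> ran (lg_label (H i))" "y \<in> ran (lg_label (H j))"
proof -
  have "(j, y) \<in> glue I H (i, x)" using assms(1) by (simp add: glue_def)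
  then have *: "((i, x), (j, y)) \<in> (common_label I H)\<^sup>*" by (simp add: glue_def)
  from * assms(2) show "x \<in> ran (lg_label (H i))"
    by (cases rule: converse_rtranclE) (auto simp: common_label_def ran_def)
  from * assms(2) show "y \<in> ran (lg_label (H j))"
    by (cases rule: rtranclE) (auto simp: common_label_def ran_def)
qed

text \<open>The definite description is well defined because all vertices with one label are
  glued.\<close>

lemma lg_label_product:
  assumes "i \<in> I" "lg_label (H i) l = Some x"
  shows "lg_label (lg_product I H) l = Some (glue I H (i, x))"
proof -
  have "(THE X. \<exists>i\<in>I. \<exists>x. lg_label (H i) l = Some x \<and> X = glue I H (i, x)) = glue I H (i, x)"
  proof (rule the_equality)
    show "\<exists>j\<in>I. \<exists>y. lg_label (H j) l = Some y \<and> glue I H (i, x) = glue I H (j, y)"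
      using assms by blast
    fix X assume "\<exists>j\<in>I. \<exists>y. lg_label (H j) l = Some y \<and> X = glue I H (j, y)"
    then obtain j y where j: "j \<in> I" "lg_label (H j) l = Some y" "X = glue I H (j, y)" by blast
    then have "((j, y), (i, x)) \<in> common_label I H" using assms by (auto simp: common_label_def)
    with j(3) show "X = glue I H (i, x)" by (simp add: glue_eq)
  qed
  moreover have "\<exists>i\<in>I. l \<in> dom (lg_label (H i))" using assms by blast
  ultimately show ?thesis by (simp add: lg_product_def)
qed

lemma lg_label_product_dom:
  "lg_label (lg_product I H) l \<noteq> None \<Longrightarrow> \<exists>i\<in>I. l \<in> dom (lg_label (H i))"
  by (simp add: lg_product_def split: if_splits)

text \<open>The interface shared by both kinds of inner nodes. Uniqueness of preimages is asked only
  over unlabelled vertices, since a product may merge labelled ones, even within one factor when a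
  vertex carries two labels.\<close>

locale projection_maps =
  fixes I :: "'n set" and H :: "'n \<Rightarrow> 'b lgraph" and K :: "'b lgraph" and m :: "'n \<Rightarrow> 'b \<Rightarrow> 'b"
  assumes vertex: "s \<in> I \<Longrightarrow> x \<in> pverts (lg_graph (H s)) \<Longrightarrow> m s x \<in> pverts (lg_graph K)"
    and surj: "y \<in> pverts (lg_graph K) \<Longrightarrow> \<exists>s\<in>I. \<exists>x\<in>pverts (lg_graph (H s)). m s x = y"
    and surj_edge: "(y, y') \<in> parcs (lg_graph K) \<Longrightarrow>
      \<exists>s\<in>I. \<exists>x x'. (x, x') \<in> parcs (lg_graph (H s)) \<and> m s x = y \<and> m s x' = y'"
    and unlabelled_unique: "y \<in> pverts (lg_graph K) - ran (lg_label K) \<Longrightarrow> s \<in> I \<Longrightarrow> s' \<in> I \<Longrightarrow>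
      x \<in> pverts (lg_graph (H s)) \<Longrightarrow> x' \<in> pverts (lg_graph (H s')) \<Longrightarrow>
      m s x = y \<Longrightarrow> m s' x' = y \<Longrightarrow> (s, x) = (s', x')"
    and labelled: "s \<in> I \<Longrightarrow> x \<in> pverts (lg_graph (H s)) \<Longrightarrow> m s x \<in> ran (lg_label K) \<Longrightarrow>
      x \<in> ran (lg_label (H s))"

lemma projection_maps_cong:
  assumes "projection_maps I H K m" and eq: "\<And>s. s \<in> I \<Longrightarrow> m' s = m s"
  shows "projection_maps I H K m'"
proof -
  interpret projection_maps I H K m by fact
  show ?thesis
  proof
    show "\<exists>s\<in>I. \<exists>x\<in>pverts (lg_graph (H s)). m' s x = y" if "y \<in> pverts (lg_graph K)" for y
      using surj[OF that] eq by fastforce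
    show "\<exists>s\<in>I. \<exists>x x'. (x, x') \<in> parcs (lg_graph (H s)) \<and> m' s x = y \<and> m' s x' = y'"
      if "(y, y') \<in> parcs (lg_graph K)" for y y'
      using surj_edge[OF that] eq by fastforce
    show "(s, x) = (s', x')" if "y \<in> pverts (lg_graph K) - ran (lg_label K)" "s \<in> I" "s' \<in> I"
      "x \<in> pverts (lg_graph (H s))" "x' \<in> pverts (lg_graph (H s'))" "m' s x = y" "m' s' x' = y"
    for y s s' x x'
      using unlabelled_unique[OF that(1-5)] that eq by simp
  qed (simp_all add: eq vertex labelled)
qed

lemma product_projection:
  assumes iso: "lgraph_iso K (lg_product I H)"
    and K: "ran (lg_label K) \<subseteq> pverts (lg_graph K)" "parcs (lg_graph K) \<subseteq> pverts (lg_graph K) \<times> pverts (lg_graph K)"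
    and H: "\<And>i. i \<in> I \<Longrightarrow> ran (lg_label (H i)) \<subseteq> pverts (lg_graph (H i))"
      "\<And>i. i \<in> I \<Longrightarrow> parcs (lg_graph (H i)) \<subseteq> pverts (lg_graph (H i)) \<times> pverts (lg_graph (H i))"
  shows "\<exists>m. projection_maps I H K m \<and> (\<forall>s\<in>I. m s ` ran (lg_label (H s)) \<subseteq> ran (lg_label K))"
proof -
  let ?VK = "pverts (lg_graph K)" and ?P = "lg_product I H"
  obtain h where bij: "bij_betw h ?VK (pverts (lg_graph ?P))"
    and edge: "\<And>u v. u \<in> ?VK \<Longrightarrow> v \<in> ?VK \<Longrightarrow>
      (u, v) \<in> parcs (lg_graph K) \<longleftrightarrow> (h u, h v) \<in> parcs (lg_graph ?P)"
    and label: "\<And>l. lg_label ?P l = map_option h (lg_label K l)"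
    using iso unfolding lgraph_iso_def by blast
  \<comment> \<open>The quotient map into the product, followed by the inverse of the
    isomorphism.\<close>
  define m where "m s x = inv_into ?VK h (glue I H (s, x))" for s x
  have VP: "glue I H (s, x) \<in> pverts (lg_graph ?P)" if "s \<in> I" "x \<in> pverts (lg_graph (H s))" for s x
    using that by (auto simp: lg_product_def)
  have m_in: "m s x \<in> ?VK" and hm: "h (m s x) = glue I H (s, x)"
    if "s \<in> I" "x \<in> pverts (lg_graph (H s))" for s x
    using inv_into_into[of "glue I H (s, x)" h ?VK] f_inv_into_f[of "glue I H (s, x)" h ?VK]
      VP[OF that] bij by (simp_all add: m_def bij_betw_def)
  have h_inj: "u = v" if "h u = h v" "u \<in> ?VK" "v \<in> ?VK" for u v
    using bij that by (auto simp: bij_betw_def inj_on_def)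
  have labelled: "m s x \<in> ran (lg_label K)" if sx: "s \<in> I" "x \<in> ran (lg_label (H s))" for s x
  proof -
    obtain l where l: "lg_label (H s) l = Some x" using sx(2) by (auto simp: ran_def)
    have x: "x \<in> pverts (lg_graph (H s))" using H(1) sx by blast
    have "map_option h (lg_label K l) = Some (h (m s x))"
      using lg_label_product[OF sx(1), of H, OF l] hm[OF sx(1) x] label by simp
    then obtain y where y: "lg_label K l = Some y" "h y = h (m s x)" by auto
    then have "y \<in> ?VK" using K(1) by (auto simp: ran_def)
    with y h_inj m_in[OF sx(1) x] have "y = m s x" by blast
    with y show ?thesis by (auto simp: ran_def)
  qed
  have "projection_maps I H K m"
  proof
    show "m s x \<in> ?VK" if "s \<in> I" "x \<in> pverts (lg_graph (H s))" for s x using m_in that .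
  next
    fix y assume y: "y \<in> ?VK"
    then have "h y \<in> pverts (lg_graph ?P)" using bij by (auto simp: bij_betw_def)
    then obtain s x where s: "s \<in> I" "x \<in> pverts (lg_graph (H s))" "h y = glue I H (s, x)"
      by (auto simp: lg_product_def)
    then have "m s x = y" using hm m_in h_inj y by metis
    with s show "\<exists>s\<in>I. \<exists>x\<in>pverts (lg_graph (H s)). m s x = y" by blast
  next
    fix y y' assume e: "(y, y') \<in> parcs (lg_graph K)"
    then have V: "y \<in> ?VK" "y' \<in> ?VK" using K(2) by auto
    with e edge have "(h y, h y') \<in> parcs (lg_graph ?P)" by blast
    then obtain s x x' where s: "s \<in> I" "(x, x') \<in> parcs (lg_graph (H s))"
      "h y = glue I H (s, x)" "h y' = glue I H (s, x')"
      by (auto simp: lg_product_def)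
    moreover from this have "x \<in> pverts (lg_graph (H s))" "x' \<in> pverts (lg_graph (H s))" using H(2) by blast+
    ultimately have "m s x = y" "m s x' = y'" using hm m_in h_inj V by metis+
    with s show "\<exists>s\<in>I. \<exists>x x'. (x, x') \<in> parcs (lg_graph (H s)) \<and> m s x = y \<and> m s x' = y'" by blast
  next
    show "(s, x) = (s', x')"
      if "y \<in> ?VK - ran (lg_label K)" "s \<in> I" "s' \<in> I" "x \<in> pverts (lg_graph (H s))"
        "x' \<in> pverts (lg_graph (H s'))" "m s x = y" "m s' x' = y" for y s s' x x'
    proof (rule ccontr)
      \<comment> \<open>Different vertices with one image are glued, hence labelled, and then their
        image is labelled as well.\<close>
      assume "(s, x) \<noteq> (s', x')"
      moreover have "glue I H (s, x) = glue I H (s', x')" using hm that by metis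
      ultimately have "x \<in> ran (lg_label (H s))" by (rule glue_labelled(1)[rotated])
      with labelled that show False by blast
    qed
  next
    fix s x assume s: "s \<in> I" "x \<in> pverts (lg_graph (H s))" and "m s x \<in> ran (lg_label K)"
    then obtain l where l: "lg_label K l = Some (m s x)" by (auto simp: ran_def)
    then have P: "lg_label ?P l = Some (glue I H (s, x))" using label hm s by simp
    \<comment> \<open>The label stems from a vertex \<open>z\<close> of some factor that is glued to
      \<open>x\<close>; so either \<open>x\<close> is this vertex or gluing shows it to be
      labelled.\<close>
    then obtain i z where i: "i \<in> I" "lg_label (H i) l = Some z" using lg_label_product_dom by blast
    then have "glue I H (s, x) = glue I H (i, z)" using lg_label_product[of i I H l z] P by simp
    then show "x \<in> ran (lg_label (H s))"
    proof (cases "(s, x) = (i, z)")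
      case True
      with i show ?thesis by (auto simp: ran_def)
    qed (rule glue_labelled(1))
  qed
  with labelled show ?thesis by blast
qed

lemma remove_label_projection:
  "projection_maps {s} H (remove_label l (H s)) (\<lambda>_ x. x)"
  by unfold_locales (auto simp: remove_label_def ran_def split: if_splits)

text \<open>Only the vertex that carries \<open>l\<close> can become unlabelled, and a second label
  may even prevent that.\<close>

lemma ran_remove_label: "ran (lg_label H) \<subseteq> insert (the (lg_label H l)) (ran (lg_label (remove_label l H)))"
proof
  fix y assume "y \<in> ran (lg_label H)"
  then obtain l' where "lg_label H l' = Some y" by (auto simp: ran_def)
  then show "y \<in> insert (the (lg_label H l)) (ran (lg_label (remove_label l H)))"
    by (cases "l' = l") (auto simp: remove_label_def ran_def)
qed

section \<open>The tree decomposition read off a construction tree\<close>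

lemma construction_tree_imp_tree_decomposition:
  assumes G: "pair_graph G" and ct: "construction_tree k (unlabelled G) T r lam"
    and depth: "elimination_depth T r \<le> q"
  shows "\<exists>\<beta>. tree_decomposition G T \<beta> \<and> td_width T \<beta> \<le> int k - 1 \<and> td_depth T \<beta> \<le> q"
proof -
  let ?Elim = "elimination_nodes T r" and ?N = "pverts T" and ?ch = "children T r"
  let ?X = "\<lambda>n. pverts (lg_graph (lam n))" and ?E = "\<lambda>n. parcs (lg_graph (lam n))"
    and ?L = "\<lambda>n. ran (lg_label (lam n))"
  have tree: "rooted_tree T r" and kl: "\<And>t. t \<in> ?N \<Longrightarrow> k_labelled k (lam t)"
    and iso: "lgraph_iso (lam r) (unlabelled G)"
    and full: "\<And>t. t \<in> leaves T r \<Longrightarrow> fully_labelled (lam t)"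
    and elim: "\<And>t s. t \<in> ?N \<Longrightarrow> ?ch t = {s} \<Longrightarrow>
      \<exists>l\<in>dom (lg_label (lam s)). lam t = remove_label l (lam s)"
    and prod: "\<And>t. t \<in> ?N \<Longrightarrow> card (?ch t) > 1 \<Longrightarrow> lgraph_iso (lam t) (lg_product (?ch t) lam)"
    using ct unfolding construction_tree_def by blast+
  obtain par d where P: "parent_tree ?N r par d" "T = parent_forest.graph ?N {r} par"
    using rooted_tree_imp_parent_tree[OF tree] by blast
  interpret P: parent_tree ?N r par d by (rule P)
  have ch: "?ch t = {s \<in> ?N - {r}. par s = t}" for t
    using P.children_graph P(2) by simp
  have lab: "?L n \<subseteq> ?X n" "?E n \<subseteq> ?X n \<times> ?X n" "dom (lg_label (lam n)) \<subseteq> {1..k}" if "n \<in> ?N" for n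
    using kl[OF that] by (auto simp: k_labelled_def pair_graph_iff)
  \<comment> \<open>Several labels may sit on one vertex, so \<open>k\<close> labels give at most
    \<open>k\<close> labelled vertices.\<close>
  have ran_image: "?L n = (\<lambda>l. the (lg_label (lam n) l)) ` dom (lg_label (lam n))" for n
    by (force simp: ran_def dom_def image_iff)
  have finL: "finite (?L n)" and cardL: "card (?L n) \<le> k" if "n \<in> ?N" for n
  proof -
    have fin: "finite (dom (lg_label (lam n)))" using lab(3)[OF that] finite_subset by blast
    then show "finite (?L n)" unfolding ran_image by simp
    have "card (?L n) \<le> card (dom (lg_label (lam n)))"
      unfolding ran_image using fin by (rule card_image_le)
    also have "\<dots> \<le> card {1..k}" using lab(3)[OF that] by (intro card_mono) auto
    finally show "card (?L n) \<le> k" by simp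
  qed
  let ?Q = "\<lambda>t m. projection_maps (?ch t) lam (lam t) m \<and>
    (t \<in> ?Elim \<longrightarrow> (\<forall>s\<in>?ch t. \<exists>z. m s ` ?L s \<subseteq> insert z (?L t))) \<and>
    (t \<notin> ?Elim \<longrightarrow> (\<forall>s\<in>?ch t. m s ` ?L s \<subseteq> ?L t))"
  have "\<exists>m. ?Q t m" if t: "t \<in> ?N" "?ch t \<noteq> {}" for t
  proof (cases "t \<in> ?Elim")
    case True
    then obtain s where s: "?ch t = {s}" by (auto simp: elimination_nodes_def card_1_singleton_iff)
    with elim t obtain l where l: "lam t = remove_label l (lam s)" by blast
    have "?L s \<subseteq> insert (the (lg_label (lam s) l)) (?L t)" unfolding l by (rule ran_remove_label)
    then have "?Q t (\<lambda>_ x. x)"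
      using True remove_label_projection[of s lam l] unfolding s l by auto
    then show ?thesis by blast
  next
    case False
    have "finite (?ch t)" using P.finite_V by (simp add: ch)
    then have "card (?ch t) > 1"
      using False t by (cases "card (?ch t)") (auto simp: elimination_nodes_def card_eq_0_iff)
    then have "lgraph_iso (lam t) (lg_product (?ch t) lam)" by (rule prod[OF t(1)])
    then obtain m where "projection_maps (?ch t) lam (lam t) m" "\<forall>s\<in>?ch t. m s ` ?L s \<subseteq> ?L t"
      using product_projection[of "lam t" "?ch t" lam] lab t ch by auto
    with False show ?thesis by blast
  qed
  then obtain M where M: "\<And>t. t \<in> ?N \<Longrightarrow> ?ch t \<noteq> {} \<Longrightarrow> ?Q t (M t)" by metis
  \<comment> \<open>The maps were chosen family by family for each parent; a child determines its
    parent, so they can be indexed by the child alone.\<close>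
  define m where "m n = M (par n) n" for n
  have MQ: "?Q t m" if "t \<in> ?N" "?ch t \<noteq> {}" for t
  proof -
    have "M t s = m s" if "s \<in> ?ch t" for s using that by (simp add: m_def ch)
    with M[OF that] projection_maps_cong[of "?ch t" lam "lam t" "M t" m] show ?thesis by simp
  qed
  have parQ: "?Q (par n) m" "n \<in> ?ch (par n)" if "n \<in> ?N - {r}" for n
  proof -
    show "n \<in> ?ch (par n)" using that by (simp add: ch)
    then show "?Q (par n) m" using MQ[of "par n"] P.par_in[OF that] by blast
  qed
  have parP: "projection_maps (?ch (par n)) lam (lam (par n)) m" if "n \<in> ?N - {r}" for n
    using parQ(1)[OF that] by blast
  obtain f where f: "bij_betw f (?X r) (pverts G)"
    and f_edge: "\<And>u v. u \<in> ?X r \<Longrightarrow> v \<in> ?X r \<Longrightarrow> (u, v) \<in> ?E r \<longleftrightarrow> (f u, f v) \<in> parcs G"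
    and f_label: "\<And>l. None = map_option f (lg_label (lam r) l)"
    using iso unfolding lgraph_iso_def unlabelled_def by auto
  \<comment> \<open>\<open>g n\<close> composes the maps from \<open>n\<close> up to the root and
    ends with the isomorphism \<open>f\<close>; the recursion follows the parent function, which is
    well-founded by \<open>d\<close>.\<close>
  have "\<exists>g. \<forall>n. g n = (if n \<in> ?N - {r} then g (par n) \<circ> m n else f)"
  proof (rule dependent_wf_choice[where R = "P.up\<inverse>"
        and P = "\<lambda>g n x. x = (if n \<in> ?N - {r} then g (par n) \<circ> m n else f)"])
    have "P.up\<inverse> \<subseteq> measure d" using P.par_d by (auto simp: P.up_iff)
    then show "wf (P.up\<inverse>)" by (rule wf_subset[OF wf_measure])
  qed (auto simp: P.up_iff)
  then obtain g where g: "\<And>n. g n = (if n \<in> ?N - {r} then g (par n) \<circ> m n else f)" by metis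
  have gr: "g r = f" using g[of r] by simp
  interpret vertex_maps ?N r par d G ?X ?E ?L m g ?Elim
  proof (unfold_locales, unfold P(2)[symmetric])
    show "bij_betw (g r) (?X r) (pverts G)" unfolding gr by (rule f)
    show "\<exists>x y. (x, y) \<in> ?E r \<and> g r x = u \<and> g r y = v" if uv: "(u, v) \<in> parcs G" for u v
    proof -
      have "u \<in> f ` ?X r" "v \<in> f ` ?X r" using uv G f by (auto simp: pair_graph_iff bij_betw_def)
      then show ?thesis unfolding gr using f_edge uv by blast
    qed
    show "?L r = {}" using f_label by (auto simp: ran_def)
    show "?E n \<subseteq> ?X n \<times> ?X n" "?L n \<subseteq> ?X n" "finite (?L n)" if "n \<in> ?N" for n
      using lab[OF that] finL[OF that] by auto
    show "g n x = g (par n) (m n x)" if "n \<in> ?N - {r}" for n x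
      using g[of n] that by simp
    show "m n x \<in> ?X (par n)" if "n \<in> ?N - {r}" "x \<in> ?X n" for n x
      using projection_maps.vertex[OF parP[OF that(1)] parQ(2)[OF that(1)] that(2)] .
    show "?X n = ?L n" if "n \<in> ?N" "?ch n = {}" for n
      using full[of n] lab(1)[of n] that by (auto simp: leaves_def fully_labelled_def)
    show "\<exists>s\<in>?ch n. \<exists>x\<in>?X s. m s x = y" if "n \<in> ?N" "?ch n \<noteq> {}" "y \<in> ?X n" for n y
      using projection_maps.surj MQ[OF that(1,2)] that(3) by metis
    show "\<exists>s\<in>?ch n. \<exists>x x'. (x, x') \<in> ?E s \<and> m s x = y \<and> m s x' = y'"
      if "n \<in> ?N" "?ch n \<noteq> {}" "(y, y') \<in> ?E n" for n y y'
      using projection_maps.surj_edge MQ[OF that(1,2)] that(3) by metis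
    show "s = s' \<and> x = x'" if n: "n \<in> ?N" "y \<in> ?X n - ?L n" "s \<in> ?ch n" "s' \<in> ?ch n"
      "x \<in> ?X s" "x' \<in> ?X s'" "m s x = y" "m s' x' = y" for n y s s' x x'
    proof -
      have "projection_maps (?ch n) lam (lam n) m" using MQ[OF n(1)] n(3) by blast
      then show ?thesis using projection_maps.unlabelled_unique[OF _ n(2-8)] by simp
    qed
    show "x \<in> ?L n" if "n \<in> ?N - {r}" "x \<in> ?X n" "m n x \<in> ?L (par n)" for n x
      using projection_maps.labelled[OF parP[OF that(1)] parQ(2)[OF that(1)] that(2,3)] .
    show "\<exists>z. m n ` ?L n \<subseteq> insert z (?L (par n))" if "n \<in> ?N - {r}" "par n \<in> ?Elim" for n
      using parQ[OF that(1)] that(2) by blast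
    show "m n ` ?L n \<subseteq> ?L (par n)" if "n \<in> ?N - {r}" "par n \<notin> ?Elim" for n
      using parQ[OF that(1)] that(2) by blast
  qed
  have T: "P.graph = T" using P(2) by simp
  have N: "finite ?N" "?N \<noteq> {}" using P.finite_V P.r_in by auto
  have "card (bag n) \<le> k" if "n \<in> ?N" for n
    using card_image_le[OF finL[OF that], of "g n"] cardL[OF that] by (simp add: bag_def)
  then have "Max ((\<lambda>t. card (bag t)) ` ?N) \<le> k" using N by simp
  then have "td_width T bag \<le> int k - 1" by (simp add: td_width_def)
  moreover have "td_depth T bag \<le> q"
  proof -
    have "card (\<Union>t\<in>{t. on_path T r t v}. bag t) \<le> q" if v: "v \<in> ?N" for v
    proof -
      have Z: "{s. P.le v s} \<subseteq> ?N" "{s. P.le v s} \<noteq> {}" using P.le_inD P.le_refl[OF v] by blast+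
      \<comment> \<open>The depth ranges over all nodes \<open>v\<close>, the elimination depth only
        over leaves, so the path to \<open>v\<close> is prolonged to a leaf \<open>w\<close> below
        it.\<close>
      obtain w where w: "P.le v w" and max: "\<And>s. P.le v s \<Longrightarrow> d s \<le> d w"
        using P.ex_max_depth[OF Z] by auto
      have "?ch w = {}"
      proof (rule ccontr)
        assume "?ch w \<noteq> {}"
        then obtain s where s: "s \<in> ?N - {r}" "par s = w" by (auto simp: ch)
        then have "P.le v s" using w P.le_par P.le_trans by blast
        with max P.par_d s show False by fastforce
      qed
      then have wl: "w \<in> leaves T r" using w P.le_inD by (simp add: leaves_def)
      have "card (\<Union>t\<in>{t. on_path T r t v}. bag t) \<le> card {t \<in> ?Elim. P.le t v \<and> t \<noteq> v}"
        using path_bags[OF v] P.on_path_tree T by simp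
      also have "\<dots> \<le> card {t \<in> ?Elim. on_path T r t w}"
      proof (rule card_mono)
        show "finite {t \<in> ?Elim. on_path T r t w}" using N by (auto simp: elimination_nodes_def)
        show "{t \<in> ?Elim. P.le t v \<and> t \<noteq> v} \<subseteq> {t \<in> ?Elim. on_path T r t w}"
          using P.le_trans[OF _ w] P.on_path_tree T by auto
      qed
      also have "\<dots> \<le> elimination_depth T r"
        unfolding elimination_depth_def using wl N by (intro Max_ge) (auto simp: leaves_def)
      finally show ?thesis using depth by simp
    qed
    then have "Max ((\<lambda>v. card (\<Union>t\<in>{t. on_path T r t v}. bag t)) ` ?N) \<le> q"
      using N by (simp add: Max_le_iff)
    \<comment> \<open>The root \<open>r\<close> of the construction tree is one candidate in the
      minimum that defines the depth.\<close>
    then show ?thesis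
      unfolding td_depth_def using N P.r_in by (meson Min_le finite_imageI imageI order_trans)
  qed
  ultimately show ?thesis using tree_decomposition_bag T by auto
qed

section \<open>The three equivalent conditions\<close>

lemma lgraph_iso_trans:
  assumes "lgraph_iso H K" "lgraph_iso K M"
  shows "lgraph_iso H M"
proof -
  obtain f where f: "bij_betw f (pverts (lg_graph H)) (pverts (lg_graph K))"
    "\<forall>u\<in>pverts (lg_graph H). \<forall>v\<in>pverts (lg_graph H).
       (u, v) \<in> parcs (lg_graph H) \<longleftrightarrow> (f u, f v) \<in> parcs (lg_graph K)"
    "\<forall>l. lg_label K l = map_option f (lg_label H l)"
    using assms(1) unfolding lgraph_iso_def by blast
  obtain g where g: "bij_betw g (pverts (lg_graph K)) (pverts (lg_graph M))"
    "\<forall>u\<in>pverts (lg_graph K). \<forall>v\<in>pverts (lg_graph K).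
       (u, v) \<in> parcs (lg_graph K) \<longleftrightarrow> (g u, g v) \<in> parcs (lg_graph M)"
    "\<forall>l. lg_label M l = map_option g (lg_label K l)"
    using assms(2) unfolding lgraph_iso_def by blast
  have fK: "f u \<in> pverts (lg_graph K)" if "u \<in> pverts (lg_graph H)" for u
    using f(1) that by (auto simp: bij_betw_def)
  show ?thesis
    unfolding lgraph_iso_def
  proof (intro exI[of _ "g \<circ> f"] conjI ballI allI)
    show "bij_betw (g \<circ> f) (pverts (lg_graph H)) (pverts (lg_graph M))"
      using f(1) g(1) by (rule bij_betw_trans)
  qed (use f(2,3) g(2,3) fK in \<open>auto simp: option.map_comp\<close>)
qed

lemma lgraph_iso_map_pair_graph:
  assumes "pair_graph G" "inj_on f (pverts G)"
  shows "lgraph_iso (unlabelled (map_pair_graph f G)) (unlabelled G)"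
  unfolding lgraph_iso_def
proof (intro exI[of _ "inv_into (pverts G) f"] conjI ballI allI)
  have "bij_betw f (pverts G) (f ` pverts G)" using assms(2) by (simp add: bij_betw_def)
  then show "bij_betw (inv_into (pverts G) f) (pverts (lg_graph (unlabelled (map_pair_graph f G))))
      (pverts (lg_graph (unlabelled G)))"
    by (simp add: unlabelled_def map_pair_graph_def bij_betw_inv_into)
next
  fix a b assume "a \<in> pverts (lg_graph (unlabelled (map_pair_graph f G)))"
    "b \<in> pverts (lg_graph (unlabelled (map_pair_graph f G)))"
  then obtain u v where uv: "u \<in> pverts G" "v \<in> pverts G" "a = f u" "b = f v"
    by (auto simp: unlabelled_def map_pair_graph_def)
  have "(f u, f v) \<in> map_prod f f ` parcs G \<longleftrightarrow> (u, v) \<in> parcs G"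
  proof
    assume "(f u, f v) \<in> map_prod f f ` parcs G"
    then obtain x y where xy: "(x, y) \<in> parcs G" "f u = f x" "f v = f y" by auto
    then have "x \<in> pverts G" "y \<in> pverts G" using assms(1) by (auto simp: pair_graph_iff)
    with xy uv assms(2) show "(u, v) \<in> parcs G" by (auto simp: inj_on_def)
  qed force
  then show "(a, b) \<in> parcs (lg_graph (unlabelled (map_pair_graph f G))) \<longleftrightarrow>
      (inv_into (pverts G) f a, inv_into (pverts G) f b) \<in> parcs (lg_graph (unlabelled G))"
    using uv assms(2) by (simp add: unlabelled_def map_pair_graph_def)
qed (simp add: unlabelled_def)

lemma pebbled_order_imp_construction_tree:
  assumes G: "pair_graph G" and p: "pebbled_order k q G le p"
  shows "\<exists>(T :: nat pair_pre_digraph) r (lam :: nat \<Rightarrow> nat lgraph).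
    construction_tree k (unlabelled G) T r lam \<and> elimination_depth T r \<le> q"
proof -
  have "finite (pverts G)" using G by (simp add: pair_graph_iff)
  then obtain idx where "bij_betw idx (pverts G) {0..<card (pverts G)}"
    using ex_bij_betw_finite_nat by blast
  \<comment> \<open>\<open>Suc\<close> keeps 0 free for the virtual root.\<close>
  then have inj: "inj_on (Suc \<circ> idx) (pverts G)" by (simp add: bij_betw_def inj_on_def)
  define H where "H = map_pair_graph (Suc \<circ> idx) G"
  obtain le' p' where p': "pebbled_order k q H le' p'"
    using pebbled_order_map[OF G inj p] unfolding H_def by blast
  then have "forest_order (pverts H) le'" by (simp add: pebbled_order_def)
  then obtain R par d where P: "parent_forest (pverts H) R par d"
      "parent_forest.le (pverts H) R par = le'"
    using forest_order.ex_parent_forest by blast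
  interpret P: pebbled_parent_forest H R par d k q p'
  proof (intro pebbled_parent_forest.intro pebbled_parent_forest_axioms.intro P(1))
    show "pair_graph H" unfolding H_def by (rule pair_graph_map[OF G inj])
    show "0 \<notin> pverts H" by (auto simp: H_def map_pair_graph_def)
  qed (simp add: P(2) p')
  \<comment> \<open>\<open>construction_tree\<close> refers to its graph only through an isomorphism
    at the root, so the tree built for the renamed graph \<open>H\<close> also serves
    \<open>G\<close>.\<close>
  have "construction_tree k (unlabelled G) P.T.graph 0 P.lam"
    using P.construction_tree_T lgraph_iso_trans lgraph_iso_map_pair_graph[OF G inj]
    unfolding construction_tree_def H_def by blast
  with P.elimination_depth_T show ?thesis by blast
qed

theorem theorem14:
  fixes G :: "'a pair_pre_digraph" and k q :: nat
  assumes "k \<ge> 1" and "q \<ge> 1" and "pair_graph G"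
  shows
    "((\<exists>(T :: nat pair_pre_digraph) r (lam :: nat \<Rightarrow> nat lgraph).
          construction_tree k (unlabelled G) T r lam \<and> elimination_depth T r \<le> q) \<longleftrightarrow>
      (\<exists>(T :: nat pair_pre_digraph) (\<beta> :: nat \<Rightarrow> 'a set).
          tree_decomposition G T \<beta> \<and> td_width T \<beta> \<le> int k - 1 \<and> td_depth T \<beta> \<le> q)) \<and>
     ((\<exists>(T :: nat pair_pre_digraph) (\<beta> :: nat \<Rightarrow> 'a set).
          tree_decomposition G T \<beta> \<and> td_width T \<beta> \<le> int k - 1 \<and> td_depth T \<beta> \<le> q) \<longleftrightarrow>
      G \<in> pebble_forest_class k q)"
    (is "(?CT \<longleftrightarrow> ?TD) \<and> (?TD \<longleftrightarrow> ?PF)")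
proof -
  have ?TD if ?CT
  proof -
    from that obtain T :: "nat pair_pre_digraph" and r and lam :: "nat \<Rightarrow> nat lgraph"
      where "construction_tree k (unlabelled G) T r lam" "elimination_depth T r \<le> q" by blast
    from construction_tree_imp_tree_decomposition[OF assms(3) this] show ?thesis by blast
  qed
  moreover have "\<exists>le p. pebbled_order k q G le p" if ?TD
    using that tree_decomposition_imp_pebbled_order[OF assms(3)] by metis
  moreover have ?CT if "\<exists>le p. pebbled_order k q G le p"
    using that pebbled_order_imp_construction_tree[OF assms(3)] by metis
  ultimately show ?thesis
    unfolding pebble_forest_class_iff[OF assms(3)] by satx
qed

end
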